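(* There are absolute constants $c,C>0$ such that for $L>0$, $\tau\ge2$, $\sigma>0$ and $k\in\mathbb{N}$, $$P\big(\#\{z\in B_\tau(0)\cap\mathcal{Z}^{(L)}:\ S^{(L)}(z)<\sigma\}\ge k\big)\le e^{-cL^2\tau^4}+e^{CL^2\tau^4\log_*(\max\{L,L^{-1}\}\tau)}\,\sigma^k.$$
   Context: Notation: $\log_*(x)=\max\{1,\log x\}$; $B_r(z)$ is the disc in $\mathbb{C}$ with centre $z$ and radius $r$; $\mathbb{N}=\{1,2,\dots\}$. Gaussian entire function (GEF): for $L>0$, $F_L(z)=\sum_{n=0}^\infty \zeta_n\frac{(\sqrt{L}z)^n}{\sqrt{n!}}$, where $\zeta_n$ ($n\ge0$) are i.i.d. standard complex normal random variables, and $\mathcal{Z}^{(L)}$ denotes the zero set of $F_L$ (almost surely all zeroes are simple). Product separation: for $z\in\mathcal{Z}^{(L)}$, $S^{(L)}(z)=\prod_{w\in B_1(z)\cap\mathcal{Z}^{(L)}\setminus\{z\}}|z-w|$ (an empty product equals $1$). *)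

theory Defs
  imports "HOL-Probability.Probability"
begin

definition log_star :: "real \<Rightarrow> real" where
  "log_star x = max 1 (ln x)"

(* Normalised so that the mean is 0 and the second absolute moment is 1. *)
definition std_complex_normal_density :: "complex \<Rightarrow> real" where
  "std_complex_normal_density z = exp (- (cmod z)\<^sup>2) / pi"

definition iid_std_complex_normal ::
    "'a measure \<Rightarrow> (nat \<Rightarrow> 'a \<Rightarrow> complex) \<Rightarrow> bool" where
  "iid_std_complex_normal M \<zeta> \<longleftrightarrow>
     prob_space M \<and>
     prob_space.indep_vars M (\<lambda>_. borel) \<zeta> UNIV \<and>
     (\<forall>n. distributed M lborel (\<zeta> n) (\<lambda>z. ennreal (std_complex_normal_density z)))"

(* The function is written in terms of one realisation a of the coefficient sequence.
   For i.i.d. standard complex normal coefficients the series almost surely converges for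
   every z; on the exceptional null set the value of suminf is irrelevant. *)
definition GEF :: "real \<Rightarrow> (nat \<Rightarrow> complex) \<Rightarrow> complex \<Rightarrow> complex" where
  "GEF L a z = (\<Sum>n. a n * (of_real (sqrt L) * z) ^ n / of_real (sqrt (fact n)))"

definition GEF_zeros :: "real \<Rightarrow> (nat \<Rightarrow> complex) \<Rightarrow> complex set" where
  "GEF_zeros L a = {z. GEF L a z = 0}"

(* Almost surely the zero set is locally finite, so that the library conventions for
   products over, and cardinalities of, infinite sets only matter on a null set. *)
definition prod_sep :: "real \<Rightarrow> (nat \<Rightarrow> complex) \<Rightarrow> complex \<Rightarrow> real" where
  "prod_sep L a z = (\<Prod>w \<in> (ball z 1 \<inter> GEF_zeros L a) - {z}. cmod (z - w))"

(* The underlying probability space need not be complete, while the defining property of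
   this event is controlled only up to a null set (see above); its probability is
   therefore taken with respect to the completion. *)
definition many_close_zeros ::
    "'a measure \<Rightarrow> (nat \<Rightarrow> 'a \<Rightarrow> complex) \<Rightarrow> real \<Rightarrow> real \<Rightarrow> real \<Rightarrow> nat \<Rightarrow> 'a set" where
  "many_close_zeros M \<zeta> L \<tau> \<sigma> k =
     {\<omega> \<in> space M.
        card {z \<in> ball 0 \<tau> \<inter> GEF_zeros L (\<lambda>n. \<zeta> n \<omega>).
                prod_sep L (\<lambda>n. \<zeta> n \<omega>) z < \<sigma>} \<ge> k}"

end

theory Submission
  imports Defs "HOL-Complex_Analysis.Complex_Analysis"
begin

text \<open>
  The zeros \<open>z\<^sub>1, \<dots>, z\<^sub>n\<close> of the Gaussian entire function in a disc repel each other: their joint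
  density carries the squared Vandermonde product
  \<open>\<Prod>\<^sub>i\<^sub><\<^sub>j |z\<^sub>i - z\<^sub>j|\<^sup>2 = \<Prod>\<^sub>i \<Prod>\<^sub>j\<^sub>\<noteq>\<^sub>i |z\<^sub>i - z\<^sub>j|\<close>.
  Grouped by \<open>i\<close>, the factors shorter than \<open>1\<close> form the product separation of \<open>z\<^sub>i\<close>, so that each of
  the \<open>k\<close> points with product separation below \<open>\<sigma>\<close> contributes a factor at most \<open>\<sigma>\<close>
  (\<open>prod_dist_close_points_le\<close>). The other factors are at most the diameter of the disc. There are
  fewer than \<open>n\<^sup>2\<close> of them, and \<open>n\<close> is at most a multiple of the mean number \<open>m = L (\<tau> + 1)\<^sup>2\<close>,
  provided that \<open>m\<close> is bounded away from \<open>0\<close>, outside an event of probability at most \<open>exp (- m\<^sup>2)\<close>. This accounts for the factor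
  \<open>exp (C L\<^sup>2 \<tau>\<^sup>4 log\<^sub>* \<dots>)\<close>.

  The density is replaced by a net of mesh \<open>\<epsilon>\<close>. Let \<open>y\<^sub>i\<close> be a net point near \<open>z\<^sub>i\<close>. Since
  \<open>F(z) = H(z) \<Prod>\<^sub>j (z - z\<^sub>j)\<close> with \<open>H\<close> bounded by the maximum principle (\<open>norm_le_prod_zeros\<close>),
  \<open>F(y\<^sub>i)\<close> is of order \<open>\<epsilon> \<Prod>\<^sub>j\<^sub>\<noteq>\<^sub>i |y\<^sub>i - y\<^sub>j|\<close>. The divided difference \<open>F[y\<^sub>0, \<dots>, y\<^sub>i]\<close> is the sum of a
  constant multiple of the coefficient \<open>\<zeta>\<^sub>i\<close> and of a function of the later coefficients
  (\<open>divided_difference_GEF\<close>), and it is of order \<open>\<epsilon> \<Prod>\<^sub>s\<^sub>>\<^sub>i |y\<^sub>i - y\<^sub>s|\<close> if the zeros are listed in a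
  suitable greedy order (\<open>reverse_Leja_order\<close>, \<open>divided_difference_near_zeros\<close>). Conditioning on the
  later coefficients, one index after the other, bounds the probability that all these divided
  differences are that small by a constant times \<open>\<epsilon>\<^sup>2\<^sup>n\<close> times the Vandermonde product
  (\<open>prob_triangular_le\<close>). The number of net configurations is of order \<open>\<epsilon>\<^sup>-\<^sup>2\<^sup>n\<close>, so \<open>\<epsilon>\<close> cancels
  (\<open>prob_net_event_le\<close>), and \<open>\<epsilon>\<close> tends to \<open>0\<close> in \<open>prob_many_close_zeros_uncrowded\<close>. Multiple zeros
  need no separate treatment, because only distinct zeros are factored out.

  If there are many more than \<open>m\<close> zeros, factoring them out shows that \<open>F\<close> is exponentially small on
  the disc, and by Cauchy's estimates so are its first \<open>\<lceil>m\<rceil>\<close> coefficients. These are independent, so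
  this has probability at most \<open>exp (- m\<^sup>2) / 2\<close> (\<open>crowded_imp_small_coeffs\<close>,
  \<open>prob_small_coeffs\<close>). If \<open>m\<close> itself is small, the constant term dominates the series with
  probability at least \<open>1/2\<close> and there is no zero at all (\<open>prob_many_close_zeros_sparse\<close>).

  The event is measurable up to a null set because having \<open>k\<close> points of small product separation is
  an open and monotone property of finite configurations: it can be detected by finitely many small
  closed discs with centres in a countable dense set, all of which meet the zero set
  (\<open>ex_close_configuration\<close>).
\<close>

section \<open>The random power series\<close>

definition gef_weight :: "real \<Rightarrow> nat \<Rightarrow> real" where
  "gef_weight L n = sqrt (L ^ n / fact n)"

text \<open>
  A deterministic growth condition under which every estimate on the series below holds. It fails
  with probability at most \<open>exp (- t\<^sup>2) / 4\<close>, and yet costs only a factor linear in \<open>t\<close> in the maximum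
  of the series.
\<close>
definition tempered :: "real \<Rightarrow> (nat \<Rightarrow> complex) \<Rightarrow> bool" where
  "tempered t a \<longleftrightarrow> (\<forall>j. (cmod (a j))\<^sup>2 \<le> 2 * t\<^sup>2 + 2 * real j + 6)"

lemma gef_weight_pos: "L > 0 \<Longrightarrow> gef_weight L n > 0"
  by (simp add: gef_weight_def)

lemma GEF_eq_weighted:
  assumes "L > 0"
  shows "GEF L a z = (\<Sum>n. a n * of_real (gef_weight L n) * z ^ n)"
proof -
  have "a n * (of_real (sqrt L) * z) ^ n / of_real (sqrt (fact n))
      = a n * of_real (gef_weight L n) * z ^ n" for n
    using assms
    by (simp add: gef_weight_def power_mult_distrib real_sqrt_divide real_sqrt_power field_simps
        flip: of_real_power)
  then show ?thesis
    unfolding GEF_def by presburger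
qed

definition gef_fps :: "real \<Rightarrow> (nat \<Rightarrow> complex) \<Rightarrow> complex fps" where
  "gef_fps L a = Abs_fps (\<lambda>n. a n * of_real (gef_weight L n))"

lemma GEF_eq_eval_fps: "L > 0 \<Longrightarrow> GEF L a = eval_fps (gef_fps L a)"
  by (rule ext) (simp add: GEF_eq_weighted eval_fps_def gef_fps_def)

text \<open>
  The growth of the coefficients is absorbed into a geometric factor \<open>2\<^sup>n\<close>, and the square root of
  \<open>(4 L r\<^sup>2)\<^sup>n / n!\<close> is traded for an exponential series by the inequality between the geometric and
  the arithmetic mean, applied with the summable weights \<open>2\<^sup>-\<^sup>n\<close>.
\<close>
lemma tempered_term_bound:
  assumes "tempered t a" "t \<ge> 0" "L > 0" "cmod z \<le> r"
  shows "cmod (a n * of_real (gef_weight L n) * z ^ n)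
    \<le> (2 * t + 3) * (((4 * L * r\<^sup>2) ^ n / fact n + (1 / 2) ^ n) / 2)"
proof -
  have r: "r \<ge> 0" using assms(4) norm_ge_zero[of z] by linarith
  have "real n + 1 \<le> 2 ^ n"
    by (induction n) auto
  have "(cmod (a n))\<^sup>2 \<le> 2 * t\<^sup>2 + 2 * real n + 6"
    using assms(1) by (simp add: tempered_def)
  also have "\<dots> \<le> (2 * t + 3)\<^sup>2 * (real n + 1)"
  proof -
    have "(2 * t + 3)\<^sup>2 * (real n + 1) - (2 * t\<^sup>2 + 2 * real n + 6)
        = (4 * t\<^sup>2 + 12 * t + 7) * real n + 2 * t\<^sup>2 + 12 * t + 3"
      by (simp add: power2_eq_square algebra_simps)
    moreover have "\<dots> \<ge> 0" using \<open>t \<ge> 0\<close> by simp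
    ultimately show ?thesis by linarith
  qed
  also have "\<dots> \<le> (2 * t + 3)\<^sup>2 * 2 ^ n"
    using \<open>real n + 1 \<le> 2 ^ n\<close> by (intro mult_left_mono) auto
  finally have a: "cmod (a n) \<le> (2 * t + 3) * sqrt (2 ^ n)"
    using \<open>t \<ge> 0\<close> by (metis abs_of_nonneg add_nonneg_nonneg mult_nonneg_nonneg norm_ge_zero
        real_sqrt_abs real_sqrt_le_mono real_sqrt_mult zero_le_numeral)
  have "cmod (a n * of_real (gef_weight L n) * z ^ n) = cmod (a n) * gef_weight L n * cmod z ^ n"
    using gef_weight_pos[OF \<open>L > 0\<close>, of n] by (simp add: norm_mult norm_power)
  also have "\<dots> \<le> ((2 * t + 3) * sqrt (2 ^ n)) * gef_weight L n * r ^ n"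
    using a gef_weight_pos[OF \<open>L > 0\<close>, of n] assms(2,4) r
    by (intro mult_mono power_mono mult_nonneg_nonneg) auto
  also have "\<dots> = (2 * t + 3) * sqrt (((4 * L * r\<^sup>2) ^ n / fact n) * (1 / 2) ^ n)"
  proof -
    have "sqrt (2 ^ n) * gef_weight L n * r ^ n = sqrt (2 ^ n) * sqrt (L ^ n / fact n) * sqrt ((r ^ n)\<^sup>2)"
      using r by (simp add: gef_weight_def)
    also have "\<dots> = sqrt (2 ^ n * (L ^ n / fact n) * (r ^ n)\<^sup>2)"
      by (simp only: real_sqrt_mult)
    also have "2 ^ n * (L ^ n / fact n) * (r ^ n)\<^sup>2 = ((4 * L * r\<^sup>2) ^ n / fact n) * (1 / 2) ^ n"
    proof -
      have "(4 :: real) ^ n * (1 / 2) ^ n = 2 ^ n"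
        by (simp flip: power_mult_distrib)
      then show ?thesis
        by (simp add: power_mult_distrib mult_ac flip: power_mult power_mult[of r n 2])
    qed
    finally show ?thesis by (simp add: mult_ac)
  qed
  also have "\<dots> \<le> (2 * t + 3) * (((4 * L * r\<^sup>2) ^ n / fact n + (1 / 2) ^ n) / 2)"
    using assms r by (intro mult_left_mono arith_geo_mean_sqrt) auto
  finally show ?thesis .
qed

lemma gef_majorant_sums:
  "(\<lambda>n. (2 * t + 3) * (((4 * L * r\<^sup>2) ^ n / fact n + (1 / 2) ^ n) / 2))
     sums ((2 * t + 3) * ((exp (4 * L * r\<^sup>2) + 2) / 2))" for t L r :: real
proof -
  have "(\<lambda>n. (4 * L * r\<^sup>2) ^ n / fact n) sums exp (4 * L * r\<^sup>2)"
    using exp_converges[of "4 * L * r\<^sup>2"] by (simp add: field_simps)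
  moreover have "(\<lambda>n. (1 / 2 :: real) ^ n) sums 2"
    using geometric_sums[of "1 / 2 :: real"] by simp
  ultimately show ?thesis
    by (intro sums_mult sums_divide sums_add)
qed

lemma tempered_summable:
  assumes "tempered t a" "t \<ge> 0" "L > 0"
  shows "summable (\<lambda>n. cmod (a n * of_real (gef_weight L n) * z ^ n))"
  by (rule summable_comparison_test'[OF sums_summable[OF gef_majorant_sums[of t L "cmod z"]], of 0])
     (use tempered_term_bound[OF assms] in auto)

lemma GEF_bound:
  assumes "tempered t a" "t \<ge> 0" "L > 0" "cmod z \<le> r"
  shows "cmod (GEF L a z) \<le> (2 * t + 3) * ((exp (4 * L * r\<^sup>2) + 2) / 2)"
proof -
  have "cmod (GEF L a z) \<le> (\<Sum>n. cmod (a n * of_real (gef_weight L n) * z ^ n))"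
    unfolding GEF_eq_weighted[OF \<open>L > 0\<close>] by (rule summable_norm[OF tempered_summable[OF assms(1-3)]])
  also have "\<dots> \<le> (\<Sum>n. (2 * t + 3) * (((4 * L * r\<^sup>2) ^ n / fact n + (1 / 2) ^ n) / 2))"
    by (rule suminf_le[OF tempered_term_bound[OF assms] tempered_summable[OF assms(1-3)]
          sums_summable[OF gef_majorant_sums]])
  also have "\<dots> = (2 * t + 3) * ((exp (4 * L * r\<^sup>2) + 2) / 2)"
    by (rule sums_unique[OF gef_majorant_sums, symmetric])
  finally show ?thesis .
qed

lemma gef_fps_conv_radius:
  assumes "tempered t a" "t \<ge> 0" "L > 0"
  shows "fps_conv_radius (gef_fps L a) = \<infinity>"
  unfolding fps_conv_radius_def
  by (rule conv_radius_inftyI'', rule summable_norm_cancel)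
     (use tempered_summable[OF assms] in \<open>simp add: gef_fps_def\<close>)

lemma GEF_holomorphic:
  assumes "tempered t a" "t \<ge> 0" "L > 0"
  shows "GEF L a holomorphic_on UNIV"
  unfolding GEF_eq_eval_fps[OF \<open>L > 0\<close>]
  by (intro holomorphic_on_eval_fps) (simp add: gef_fps_conv_radius[OF assms] eball_def)

lemma GEF_coeff_bound:
  assumes "tempered t a" "t \<ge> 0" "L > 0" "R > 0"
    and "\<And>z. cmod z = R \<Longrightarrow> cmod (GEF L a z) \<le> B"
  shows "cmod (a n) * gef_weight L n * R ^ n \<le> B"
proof -
  have "fps_nth (gef_fps L a) n = (deriv ^^ n) (GEF L a) 0 / fact n"
    unfolding GEF_eq_eval_fps[OF \<open>L > 0\<close>]
    by (rule fps_nth_conv_deriv) (simp add: gef_fps_conv_radius[OF assms(1-3)])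
  then have "cmod (a n) * gef_weight L n = cmod ((deriv ^^ n) (GEF L a) 0) / fact n"
    using gef_weight_pos[OF \<open>L > 0\<close>, of n]
    by (simp add: gef_fps_def norm_mult norm_divide flip: of_real_mult)
      (metis abs_of_nonneg less_imp_le norm_mult norm_of_real norm_divide norm_fact)
  also have "\<dots> \<le> (fact n * B / R ^ n) / fact n"
    by (intro divide_right_mono Cauchy_inequality)
       (use assms GEF_holomorphic[OF assms(1-3)] in
         \<open>auto intro: holomorphic_on_subset continuous_on_subset holomorphic_on_imp_continuous_on\<close>)
  finally show ?thesis
    using \<open>R > 0\<close> by (simp add: field_simps)
qed

lemma GEF_0: "L > 0 \<Longrightarrow> GEF L a 0 = a 0"
proof -
  have "(\<Sum>n. a n * of_real (gef_weight L n) * 0 ^ n) = (\<Sum>n\<in>{0}. a n * of_real (gef_weight L n) * (0::complex) ^ n)"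
    by (rule suminf_finite) auto
  then show "L > 0 \<Longrightarrow> GEF L a 0 = a 0"
    by (simp add: GEF_eq_weighted gef_weight_def)
qed

lemma GEF_finite_zeros:
  assumes "tempered t a" "t \<ge> 0" "L > 0" "a 0 \<noteq> 0" 
  shows "finite (cball 0 r \<inter> GEF_zeros L a)"
proof (cases "GEF L a constant_on UNIV")
  case True
  then obtain c where "\<And>z. GEF L a z = c"
    by (auto simp: constant_on_def)
  then have "GEF_zeros L a = {}"
    using GEF_0[OF \<open>L > 0\<close>, of a] assms(4) by (auto simp: GEF_zeros_def)
  then show ?thesis by simp
next
  case False
  have "finite {z \<in> cball 0 r. GEF L a z = 0}"
    by (rule holomorphic_compact_finite_zeros[OF GEF_holomorphic[OF assms(1-3)]]) (use False in auto)
  then show ?thesis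
    by (simp add: GEF_zeros_def Int_def)
qed

text \<open>
  When the mean number of zeros is small, the terms of positive degree add up to at most \<open>1/3\<close>, so a
  constant term above \<open>1/2\<close> excludes zeros.
\<close>
lemma GEF_no_zeros_small:
  assumes "tempered t a" "t \<ge> 0" "L > 0" "t \<le> 1 / 100" "L * R\<^sup>2 \<le> 1 / 100" "R > 0" 
    and "cmod (a 0) > 1 / 2" "cmod z \<le> R"
  shows "GEF L a z \<noteq> 0"
proof -
  let ?f = "\<lambda>n. a n * of_real (gef_weight L n) * z ^ n"
  have f0: "?f 0 = a 0" by (simp add: gef_weight_def)
  have t2: "t\<^sup>2 \<le> 1/100"
    using assms(2,4) power_mono[of t "1/100" 2] by (simp add: power2_eq_square)
  \<comment> \<open>The squared coefficients are at most \<open>9 n!\<close> for \<open>n \<ge> 1\<close>, which cancels the factorial in the weight.\<close>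
  have b: "cmod (?f (Suc n)) \<le> 3 * (1 / 10) ^ Suc n" for n
  proof -
    have fac: "fact (Suc n) \<ge> real n + 1"
      using fact_ge_self[of "Suc n"] by (metis Suc_eq_plus1 add.commute of_nat_Suc of_nat_fact of_nat_mono)
    have "(cmod (a (Suc n)))\<^sup>2 \<le> 2 * t\<^sup>2 + 2 * real (Suc n) + 6"
      using assms(1) unfolding tempered_def by blast
    also have "\<dots> \<le> 9 * (real n + 1)" using t2 by simp
    also have "\<dots> \<le> 9 * fact (Suc n)" using fac by simp
    finally have a2: "(cmod (a (Suc n)))\<^sup>2 \<le> 9 * fact (Suc n)" .
    have "(cmod (?f (Suc n)))\<^sup>2 = (cmod (a (Suc n)))\<^sup>2 * (L ^ Suc n / fact (Suc n)) * ((cmod z)\<^sup>2) ^ Suc n"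
      unfolding norm_mult norm_power norm_of_real power_mult_distrib power2_abs
      using \<open>L > 0\<close> by (simp add: gef_weight_def real_sqrt_pow2 power_mult[symmetric] mult.commute del: power_Suc fact_Suc)
    also have "\<dots> \<le> (9 * fact (Suc n)) * (L ^ Suc n / fact (Suc n)) * (R\<^sup>2) ^ Suc n"
      using a2 assms by (intro mult_mono power_mono) auto
    also have "\<dots> = 9 * (L * R\<^sup>2) ^ Suc n"
      by (simp add: power_mult_distrib del: power_Suc fact_Suc)
    also have "\<dots> \<le> 9 * (1/100) ^ Suc n"
      using assms by (intro mult_left_mono power_mono) auto
    also have "\<dots> = (3 * (1/10) ^ Suc n)\<^sup>2"
      by (simp add: power_mult_distrib power2_eq_square flip: power_mult_distrib del: power_Suc)
    finally show ?thesis
      by (rule power2_le_imp_le) simp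
  qed
  have sm: "summable (\<lambda>n. cmod (?f n))" by (rule tempered_summable[OF assms(1-3)])
  then have sm': "summable (\<lambda>n. cmod (?f (Suc n)))" by (subst summable_Suc_iff)
  have g: "(\<lambda>n. 3 * (1 / 10) ^ Suc n) sums (1/3::real)"
    using sums_mult[OF geometric_sums[of "1 / 10 :: real"], of "3/10"] by simp
  have eq: "GEF L a z = a 0 + (\<Sum>n. ?f (Suc n))"
    using suminf_split_head[OF summable_norm_cancel[OF sm]] f0
    by (simp add: GEF_eq_weighted[OF \<open>L > 0\<close>])
  have "cmod (\<Sum>n. ?f (Suc n)) \<le> 1 / 3"
  proof -
    have "cmod (\<Sum>n. ?f (Suc n)) \<le> (\<Sum>n. cmod (?f (Suc n)))"
      by (rule summable_norm[OF sm'])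
    also have "\<dots> \<le> (\<Sum>n. 3 * (1 / 10) ^ Suc n)"
      by (rule suminf_le[OF b sm' sums_summable[OF g]])
    also have "\<dots> = 1 / 3"
      by (rule sums_unique[OF g, symmetric])
    finally show ?thesis .
  qed
  then have "cmod (GEF L a z) \<ge> cmod (a 0) - 1/3"
    unfolding eq using norm_diff_ineq[of "a 0" "\<Sum>n. ?f (Suc n)"] by linarith
  then show ?thesis using assms(7) by auto
qed

section \<open>Bounds through zeros, and overcrowding\<close>

text \<open>
  Dividing \<open>f\<close> by \<open>z - w\<close> for one zero after the other keeps it holomorphic, and by the maximum
  principle each division costs at most a factor \<open>\<rho> - R\<close> in its bound on the larger disc. The zeros may
  be multiple: a quotient that still vanishes does no harm.
\<close>
lemma norm_le_prod_zeros:
  fixes f :: "complex \<Rightarrow> complex"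
  assumes "finite X" and "f holomorphic_on UNIV" and "X \<subseteq> cball 0 R" and "0 < \<rho>" "R < \<rho>"
    and "\<And>w. w \<in> X \<Longrightarrow> f w = 0" and "\<And>z. cmod z \<le> \<rho> \<Longrightarrow> cmod (f z) \<le> B" and "cmod z \<le> \<rho>"
  shows "cmod (f z) \<le> B * (\<Prod>w\<in>X. cmod (z - w)) / (\<rho> - R) ^ card X"
  using assms
proof (induction X arbitrary: f B z rule: finite_induct)
  case empty
  then show ?case by simp
next
  case (insert a X)
  define g where "g z = (if z = a then deriv f a else f z / (z - a))" for z
  have fa: "f a = 0" and aR: "cmod a \<le> R"
    using insert.prems by auto
  have fg: "f z = (z - a) * g z" for z
    using fa by (simp add: g_def)
  have holg: "g holomorphic_on UNIV"
    by (rule pole_theorem_open_0[OF insert.prems(1), of a]) (use fg fa in \<open>auto simp: g_def\<close>)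
  have sphere: "cmod (g z) \<le> B / (\<rho> - R)" if "cmod z = \<rho>" for z
  proof -
    have d: "cmod (z - a) \<ge> \<rho> - R"
      using that aR norm_triangle_ineq2[of z a] by linarith
    have "cmod (g z) * (\<rho> - R) \<le> cmod (g z) * cmod (z - a)"
      using d by (intro mult_left_mono) auto
    also have "\<dots> = cmod (f z)"
      by (simp add: fg norm_mult mult.commute)
    also have "\<dots> \<le> B"
      using insert.prems(6) that by simp
    finally show ?thesis
      using \<open>R < \<rho>\<close> by (simp add: field_simps)
  qed
  have disc: "cmod (g z) \<le> B / (\<rho> - R)" if "cmod z \<le> \<rho>" for z
  proof (rule maximum_modulus_frontier[where S = "cball 0 \<rho>" and f = g and B = "B / (\<rho> - R)"])
    show "g holomorphic_on interior (cball 0 \<rho>)"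
      using holg holomorphic_on_subset by blast
    show "continuous_on (closure (cball 0 \<rho>)) g"
      using holg holomorphic_on_imp_continuous_on continuous_on_subset by blast
    show "cmod (g z) \<le> B / (\<rho> - R)" if "z \<in> frontier (cball 0 \<rho>)" for z
      using that sphere \<open>0 < \<rho>\<close> by simp
  qed (use that in auto)
  have "cmod (g z) \<le> B / (\<rho> - R) * (\<Prod>w\<in>X. cmod (z - w)) / (\<rho> - R) ^ card X"
  proof (rule insert.IH[OF holg])
    show "g w = 0" if "w \<in> X" for w
      using that insert.prems(5)[of w] insert.hyps by (auto simp: g_def)
  qed (use insert.prems disc in auto)
  then have "cmod (z - a) * cmod (g z)
      \<le> cmod (z - a) * (B / (\<rho> - R) * (\<Prod>w\<in>X. cmod (z - w)) / (\<rho> - R) ^ card X)"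
    by (intro mult_left_mono) auto
  then show ?case
    using insert.hyps by (simp add: fg norm_mult mult_ac)
qed

text \<open>
  Zeros in the disc of radius \<open>R\<close> are divided out on the disc of radius \<open>7 R\<close>, which leaves a factor
  \<open>2 R / (6 R) = 1 / 3\<close> for each of them in \<open>crowded_coeff_le\<close>.
\<close>
lemma tempered_GEF_bound:
  assumes "tempered m a" "L > 0" "R > 0" "m = L * R\<^sup>2" "cmod z \<le> 7 * R"
  shows "cmod (GEF L a z) \<le> 6 * exp (197 * m)"
proof -
  have m: "m > 0" using assms by simp
  have "4 * L * (7 * R)\<^sup>2 = 196 * m"
    using assms(4) by (simp add: power_mult_distrib)
  then have "cmod (GEF L a z) \<le> (2 * m + 3) * ((exp (196 * m) + 2) / 2)"
    using GEF_bound[OF assms(1) _ assms(2,5)] m by simp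
  also have "\<dots> \<le> (3 * exp m) * (3 / 2 * exp (196 * m))"
  proof (rule mult_mono)
    show "2 * m + 3 \<le> 3 * exp m"
      using exp_ge_add_one_self[of m] m by linarith
    have "1 \<le> exp (196 * m)" using m by simp
    then show "(exp (196 * m) + 2) / 2 \<le> 3 / 2 * exp (196 * m)" by simp
  qed (use m in auto)
  also have "\<dots> = 9 / 2 * exp (197 * m)"
    by (simp add: mult_exp_exp)
  also have "\<dots> \<le> 6 * exp (197 * m)" by simp
  finally show ?thesis .
qed

lemma GEF_le_prod_zeros:
  assumes "tempered m a" "L > 0" "R > 0" "m = L * R\<^sup>2" "cmod z \<le> 7 * R"
    and "finite X" "X \<subseteq> cball 0 R \<inter> GEF_zeros L a"
  shows "cmod (GEF L a z) \<le> 6 * exp (197 * m) / (6 * R) ^ card X * (\<Prod>w\<in>X. cmod (z - w))"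
proof -
  have "m > 0" using assms by simp
  then have "cmod (GEF L a z) \<le> 6 * exp (197 * m) * (\<Prod>w\<in>X. cmod (z - w)) / (7 * R - R) ^ card X"
    using assms tempered_GEF_bound[OF assms(1-4)]
    by (intro norm_le_prod_zeros GEF_holomorphic) (auto simp: GEF_zeros_def)
  then show ?thesis by (simp add: mult_ac)
qed

text \<open>
  Each zero makes \<open>F\<close> smaller on the disc by a factor \<open>3\<close>. Cauchy's estimates on the circle of radius
  \<open>R\<close> transfer this to the coefficients of index at most \<open>m\<close>, where the weight \<open>m\<^sup>j / j!\<close> is at
  least \<open>1\<close>.
\<close>
lemma crowded_coeff_le:
  assumes "tempered m a" "L > 0" "R > 0" "m = L * R\<^sup>2"
    and X: "finite X" "X \<subseteq> cball 0 R \<inter> GEF_zeros L a" and j: "real j \<le> m"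
  shows "cmod (a j) \<le> 6 * exp (197 * m) / 3 ^ card X"
proof -
  let ?B = "6 * exp (197 * m) / 3 ^ card X"
  have m: "m > 0" using assms by simp
  have bnd: "cmod (GEF L a z) \<le> ?B" if "cmod z = R" for z
  proof -
    have "cmod (GEF L a z) \<le> 6 * exp (197 * m) / (6 * R) ^ card X * (\<Prod>w\<in>X. cmod (z - w))"
      using assms that by (intro GEF_le_prod_zeros) auto
    also have "(\<Prod>w\<in>X. cmod (z - w)) \<le> (\<Prod>w\<in>X. 2 * R)"
    proof (intro prod_mono conjI)
      fix w assume "w \<in> X"
      then have "cmod w \<le> R" using X by auto
      then show "cmod (z - w) \<le> 2 * R"
        using norm_triangle_ineq4[of z w] that by simp
    qed simp
    then have "6 * exp (197 * m) / (6 * R) ^ card X * (\<Prod>w\<in>X. cmod (z - w))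
        \<le> 6 * exp (197 * m) / (6 * R) ^ card X * (2 * R) ^ card X"
      using \<open>R > 0\<close> by (intro mult_left_mono) auto
    also have "\<dots> = 6 * exp (197 * m) * ((2 * R) / (6 * R)) ^ card X"
      by (simp only: power_divide times_divide_eq_left times_divide_eq_right)
    also have "(2 * R) / (6 * R) = 1 / 3" using \<open>R > 0\<close> by simp
    finally show ?thesis by (simp add: power_divide)
  qed
  have "fact j \<le> (of_nat (j ^ j) :: real)"
    by (rule fact_le_power)
  also have "\<dots> = real j ^ j" by simp
  also have "\<dots> \<le> m ^ j" using j by (intro power_mono) auto
  finally have "1 \<le> m ^ j / fact j" by simp
  then have "1 \<le> sqrt (m ^ j / fact j)" by simp
  also have "\<dots> = gef_weight L j * R ^ j"
  proof -
    have "m ^ j / fact j = L ^ j / fact j * (R ^ j)\<^sup>2"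
      unfolding assms(4) power_mult_distrib by (simp add: power_mult[symmetric] mult.commute)
    then show ?thesis
      using \<open>R > 0\<close> by (simp only: real_sqrt_mult gef_weight_def) simp
  qed
  finally have "cmod (a j) * 1 \<le> cmod (a j) * (gef_weight L j * R ^ j)"
    by (intro mult_left_mono) auto
  also have "\<dots> \<le> ?B"
    using GEF_coeff_bound[OF assms(1) less_imp_le[OF m] assms(2,3) bnd, of j] by (simp add: mult_ac)
  finally show ?thesis by simp
qed

text \<open>
  With this many zeros the gain \<open>3\<^sup>N\<close> beats the a priori maximum \<open>6 exp (197 m)\<close> by a factor
  \<open>exp (m + 1)\<close>.
\<close>
definition max_zeros :: "real \<Rightarrow> nat" where
  "max_zeros m = nat \<lceil>198 * m\<rceil> + 3"

lemma exp_3_power_max_zeros: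
  assumes "m > 0"
  shows "6 * exp (197 * m) / 3 ^ max_zeros m \<le> exp (- m - 1)"
proof -
  have e: "6 \<le> exp (2 :: real)"
  proof -
    have "5/2 \<le> exp (1 :: real)"
      using exp_lower_Taylor_quadratic[of "1 :: real"] by simp
    then have "(5/2)\<^sup>2 \<le> (exp (1 :: real))\<^sup>2" by (intro power_mono) auto
    then show ?thesis by (simp add: power2_eq_square mult_exp_exp)
  qed
  have "198 * m + 3 \<le> real (max_zeros m)"
    unfolding max_zeros_def using assms by linarith
  then have "exp (198 * m + 3) \<le> exp (real (max_zeros m))" by simp
  also have "\<dots> = exp 1 ^ max_zeros m" by (simp flip: exp_of_nat_mult)
  also have "\<dots> \<le> 3 ^ max_zeros m"
    using exp_le by (intro power_mono) auto
  finally have three: "exp (198 * m + 3) \<le> 3 ^ max_zeros m" .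
  have "6 * exp (197 * m) \<le> exp 2 * exp (197 * m)" using e by simp
  also have "\<dots> = exp (- m - 1) * exp (198 * m + 3)" by (simp add: mult_exp_exp)
  also have "\<dots> \<le> exp (- m - 1) * 3 ^ max_zeros m"
    using three by (intro mult_left_mono) auto
  finally show ?thesis by (simp add: field_simps)
qed

section \<open>Independent complex Gaussian coefficients\<close>

lemma emeasure_cball_complex:
  "emeasure lborel (cball (c::complex) r) = ennreal (pi * r\<^sup>2)" if "r \<ge> 0"
  using that by (subst emeasure_cball) (simp_all add: unit_ball_vol_2)

lemma std_complex_normal_cball_le:
  assumes "r \<ge> 0"
  shows "emeasure (density lborel (\<lambda>z. ennreal (std_complex_normal_density z))) (cball c r) \<le> ennreal (r\<^sup>2)"
proof -
  have [measurable]: "std_complex_normal_density \<in> borel_measurable borel"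
    unfolding std_complex_normal_density_def by measurable
  have "emeasure (density lborel (\<lambda>z. ennreal (std_complex_normal_density z))) (cball c r)
      = (\<integral>\<^sup>+z. ennreal (std_complex_normal_density z) * indicator (cball c r) z \<partial>lborel)"
    by (subst emeasure_density) auto
  also have "\<dots> \<le> (\<integral>\<^sup>+z. ennreal (1 / pi) * indicator (cball c r) z \<partial>lborel)"
    by (intro nn_integral_mono mult_right_mono ennreal_leI)
       (auto simp: std_complex_normal_density_def field_simps)
  also have "\<dots> = ennreal (1 / pi) * ennreal (pi * r\<^sup>2)"
    by (subst nn_integral_cmult_indicator) (simp_all add: emeasure_cball_complex assms)
  also have "\<dots> = ennreal (r\<^sup>2)"
    by (subst ennreal_mult'[symmetric]) simp_all
  finally show ?thesis .
qed

text \<open>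
  An exponential Markov inequality. The moment \<open>E exp (|\<zeta>|\<^sup>2 / 2) = 2\<close> needs no polar coordinates: up to
  the rescaling \<open>z \<mapsto> z / \<surd>2\<close>, of Jacobian \<open>2\<close> in the plane, it is the total mass of the density.
\<close>
lemma std_complex_normal_tail:
  assumes prob: "emeasure (density lborel (\<lambda>z. ennreal (std_complex_normal_density z))) UNIV = 1"
  shows "emeasure (density lborel (\<lambda>z. ennreal (std_complex_normal_density z))) {z. (cmod z)\<^sup>2 > t}
     \<le> ennreal (2 * exp (- t / 2))"
proof -
  have [measurable]: "std_complex_normal_density \<in> borel_measurable borel"
    unfolding std_complex_normal_density_def by measurable
  let ?s = "sqrt 2"
  have one: "(\<integral>\<^sup>+z. ennreal (std_complex_normal_density z) \<partial>lborel) = 1"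
    using prob by (simp add: emeasure_density)
  have pt: "ennreal (std_complex_normal_density z) * indicator {z. (cmod z)\<^sup>2 > t} z
      \<le> ennreal (exp (- t / 2)) * ennreal (std_complex_normal_density (z /\<^sub>R ?s))" for z
  proof (cases "(cmod z)\<^sup>2 > t")
    case True
    have sq: "(cmod (z /\<^sub>R ?s))\<^sup>2 = (cmod z)\<^sup>2 / 2"
      by (simp add: power_mult_distrib field_simps)
    have "exp (- (cmod z)\<^sup>2) \<le> exp (- t / 2 + - ((cmod z)\<^sup>2 / 2))"
      using True by simp
    also have "\<dots> = exp (- t / 2) * exp (- ((cmod z)\<^sup>2 / 2))"
      by (rule exp_add)
    finally have "std_complex_normal_density z \<le> exp (- t / 2) * std_complex_normal_density (z /\<^sub>R ?s)"
      unfolding std_complex_normal_density_def sq times_divide_eq_right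
      by (rule divide_right_mono) simp
    then show ?thesis
      using True by (subst ennreal_mult'[symmetric]) (auto intro: ennreal_leI)
  qed simp
  have "emeasure (density lborel (\<lambda>z. ennreal (std_complex_normal_density z))) {z. (cmod z)\<^sup>2 > t}
      = (\<integral>\<^sup>+z. ennreal (std_complex_normal_density z) * indicator {z. (cmod z)\<^sup>2 > t} z \<partial>lborel)"
    by (subst emeasure_density) auto
  also have "\<dots> \<le> (\<integral>\<^sup>+z. ennreal (exp (- t / 2)) * ennreal (std_complex_normal_density (z /\<^sub>R ?s)) \<partial>lborel)"
    by (intro nn_integral_mono pt)
  also have "\<dots> = ennreal (exp (- t / 2)) * (\<integral>\<^sup>+z. ennreal (std_complex_normal_density (z /\<^sub>R ?s)) \<partial>lborel)"
    by (simp add: nn_integral_cmult)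
  also have "(\<integral>\<^sup>+z. ennreal (std_complex_normal_density (z /\<^sub>R ?s)) \<partial>lborel)
      = (\<integral>\<^sup>+z. ennreal (std_complex_normal_density (z /\<^sub>R ?s)) \<partial>(density (distr lborel borel (\<lambda>x. 0 + ?s *\<^sub>R x)) (\<lambda>_. \<bar>?s\<bar>^DIM(complex))))"
    using lborel_affine[of ?s "0::complex"] by (intro arg_cong2[where f = nn_integral]) auto
  also have "\<dots> = (\<integral>\<^sup>+z. 2 * ennreal (std_complex_normal_density z) \<partial>lborel)"
  proof (subst nn_integral_density)
    show "(\<integral>\<^sup>+z. ennreal (\<bar>?s\<bar> ^ DIM(complex)) * ennreal (std_complex_normal_density (z /\<^sub>R ?s))
         \<partial>distr lborel borel (\<lambda>x. 0 + ?s *\<^sub>R x)) = (\<integral>\<^sup>+z. 2 * ennreal (std_complex_normal_density z) \<partial>lborel)"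
      by (subst nn_integral_distr) simp_all
  qed simp_all
  also have "\<dots> = 2"
    by (simp add: nn_integral_cmult one)
  finally show ?thesis
    by (simp add: ennreal_mult' mult.commute)
qed

locale iid_complex_normal =
  fixes M :: "'a measure" and \<zeta> :: "nat \<Rightarrow> 'a \<Rightarrow> complex"
  assumes iid: "iid_std_complex_normal M \<zeta>"
begin

sublocale prob_space M
  using iid by (simp add: iid_std_complex_normal_def)

lemma measurable_coeff [measurable]: "\<zeta> n \<in> borel_measurable M"
  using iid by (auto simp: iid_std_complex_normal_def distributed_def)

lemma distr_coeff: "distr M borel (\<zeta> n) = density lborel (\<lambda>z. ennreal (std_complex_normal_density z))"
proof -
  have "distr M lborel (\<zeta> n) = density lborel (\<lambda>z. ennreal (std_complex_normal_density z))"
    using iid by (simp add: iid_std_complex_normal_def distributed_def)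
  moreover have "distr M lborel (\<zeta> n) = distr M borel (\<zeta> n)"
    by (rule distr_cong) auto
  ultimately show ?thesis by simp
qed

lemma prob_coeff_cball_le:
  assumes "r \<ge> 0"
  shows "prob {\<omega>\<in>space M. \<zeta> n \<omega> \<in> cball c r} \<le> r\<^sup>2"
proof -
  have "emeasure M {\<omega>\<in>space M. \<zeta> n \<omega> \<in> cball c r} = emeasure (distr M borel (\<zeta> n)) (cball c r)"
    by (subst emeasure_distr) (auto intro!: arg_cong[where f="emeasure M"])
  also have "\<dots> \<le> ennreal (r\<^sup>2)"
    unfolding distr_coeff by (rule std_complex_normal_cball_le[OF assms])
  finally show ?thesis
    by (simp add: emeasure_eq_measure)
qed

lemma prob_coeff_tail:
  "prob {\<omega>\<in>space M. (cmod (\<zeta> n \<omega>))\<^sup>2 > t} \<le> 2 * exp (- t / 2)"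
proof -
  have "emeasure M {\<omega>\<in>space M. (cmod (\<zeta> n \<omega>))\<^sup>2 > t} = emeasure (distr M borel (\<zeta> n)) {z. (cmod z)\<^sup>2 > t}"
    by (subst emeasure_distr) (auto intro!: arg_cong[where f="emeasure M"])
  also have "\<dots> \<le> ennreal (2 * exp (- t / 2))"
    unfolding distr_coeff
  proof (rule std_complex_normal_tail)
    interpret D: prob_space "distr M borel (\<zeta> n)" by (rule prob_space_distr) simp
    show "emeasure (density lborel (\<lambda>z. ennreal (std_complex_normal_density z))) UNIV = 1"
      using D.emeasure_space_1 unfolding distr_coeff by simp
  qed
  finally show ?thesis
    by (simp add: emeasure_eq_measure)
qed

text \<open>
  Given the coefficients of index above \<open>i\<close>, the constraint on \<open>\<zeta> i\<close> confines it to a disc of radius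
  \<open>r i / x i\<close>, whose probability is at most \<open>(r i / x i)\<^sup>2\<close> because the density is at most \<open>1/\<pi>\<close>. The
  indices are peeled off upwards from \<open>k\<close>, the event for the indices above \<open>k\<close> being a function
  of the later coefficients only.
\<close>
lemma prob_triangular_le:
  assumes h: "\<And>i. h i \<in> borel_measurable (PiM {Suc i..} (\<lambda>_. borel :: complex measure))"
    and x: "\<And>i. x i > (0::real)" and r: "\<And>i. r i \<ge> 0" and "k \<le> n"
  shows "prob {\<omega>\<in>space M. \<forall>i\<in>{k..<n}.
            cmod (of_real (x i) * \<zeta> i \<omega> + h i (restrict (\<lambda>j. \<zeta> j \<omega>) {Suc i..})) \<le> r i}
       \<le> (\<Prod>i\<in>{k..<n}. (r i / x i)\<^sup>2)"
  using \<open>k \<le> n\<close>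
proof (induction k rule: inc_induct)
  case base
  show ?case
    unfolding atLeastLessThan_empty[OF order_refl] prod.empty by (rule prob_le_1)
next
  case (step k)
  let ?P = "\<lambda>k. PiM {k..} (\<lambda>_::nat. borel :: complex measure)"
  define B where "B = {b \<in> space (?P (Suc k)). \<forall>i\<in>{Suc k..<n}.
     cmod (of_real (x i) * b i + h i (restrict b {Suc i..})) \<le> r i}"
  define W where "W \<omega> = restrict (\<lambda>j. \<zeta> j \<omega>) {Suc k..}" for \<omega>
  have W: "W \<in> measurable M (?P (Suc k))"
    unfolding W_def[abs_def] by (intro measurable_restrict measurable_coeff)
  have hm: "(\<lambda>b. h i (restrict b {Suc i..})) \<in> borel_measurable (?P (Suc k))" if "i \<ge> k" for i
  proof -
    have "(\<lambda>b. restrict b {Suc i..}) \<in> measurable (?P (Suc k)) (?P (Suc i))"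
      by (rule measurable_restrict_subset) (use that in simp)
    then show ?thesis
      by (rule measurable_compose[OF _ h])
  qed
  have Bm: "B \<in> sets (?P (Suc k))"
    unfolding B_def
  proof (rule sets.sets_Collect_finite_All)
    fix i assume i: "i \<in> {Suc k..<n}"
    have "(\<lambda>b. b i) \<in> borel_measurable (?P (Suc k))"
      using i by (intro measurable_component_singleton) auto
    then have "(\<lambda>b. of_real (x i) * b i + h i (restrict b {Suc i..})) \<in> borel_measurable (?P (Suc k))"
      using i by (intro borel_measurable_add borel_measurable_times borel_measurable_const hm) auto
    then have "(\<lambda>b. cmod (of_real (x i) * b i + h i (restrict b {Suc i..}))) \<in> borel_measurable (?P (Suc k))"
      by (rule measurable_compose[OF _ borel_measurable_norm])
    then show "{b \<in> space (?P (Suc k)). cmod (of_real (x i) * b i + h i (restrict b {Suc i..})) \<le> r i}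
        \<in> sets (?P (Suc k))"
      by (rule borel_measurable_le) simp
  qed simp
  \<comment> \<open>Two independent variables must take values in a common type, so \<open>\<zeta> k\<close> is treated as a sequence
    indexed by \<open>{k}\<close>.\<close>
  let ?Q = "PiM {k} (\<lambda>_::nat. borel :: complex measure)"
  define U where "U \<omega> = restrict (\<lambda>j. \<zeta> j \<omega>) {k}" for \<omega>
  have U: "U \<in> measurable M ?Q"
    unfolding U_def[abs_def] by (intro measurable_restrict measurable_coeff)
  let ?N = "?Q \<Otimes>\<^sub>M ?P (Suc k)"
  define S where "S = (snd -` B \<inter> space ?N) \<inter> {p \<in> space ?N. cmod (of_real (x k) * fst p k + h k (snd p)) \<le> r k}"
  have Sm: "S \<in> sets ?N"
  proof -
    have "(\<lambda>p. h k (snd p)) \<in> borel_measurable ?N"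
      by (rule measurable_compose[OF measurable_snd h])
    moreover have "(\<lambda>p. fst p k) \<in> borel_measurable ?N"
      by (rule measurable_compose[OF measurable_fst measurable_component_singleton]) simp
    ultimately have "(\<lambda>p. of_real (x k) * fst p k + h k (snd p)) \<in> borel_measurable ?N"
      by (intro borel_measurable_add borel_measurable_times borel_measurable_const)
    then have "(\<lambda>p. cmod (of_real (x k) * fst p k + h k (snd p))) \<in> borel_measurable ?N"
      by (rule measurable_compose[OF _ borel_measurable_norm])
    then have le: "{p \<in> space ?N. cmod (of_real (x k) * fst p k + h k (snd p)) \<le> r k} \<in> sets ?N"
      by (rule borel_measurable_le) simp
    show ?thesis
      unfolding S_def by (rule sets.Int[OF measurable_sets[OF measurable_snd Bm] le])
  qed
  have ind: "indep_var ?Q U (?P (Suc k)) W"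
  proof -
    have "indep_vars (\<lambda>_. borel) \<zeta> UNIV"
      using iid by (simp add: iid_std_complex_normal_def)
    from indep_var_restrict[OF this, of "{k}" "{Suc k..}"]
    show ?thesis by (simp add: W_def[abs_def] U_def[abs_def])
  qed
  interpret D: prob_space "distr M ?Q U" by (rule prob_space_distr[OF U])
  interpret DW: prob_space "distr M (?P (Suc k)) W" by (rule prob_space_distr[OF W])
  have slice: "emeasure (distr M ?Q U) ((\<lambda>u. (u, b)) -` S) \<le> ennreal ((r k / x k)\<^sup>2) * indicator B b"
    if "b \<in> space (?P (Suc k))" for b
  proof (cases "b \<in> B")
    case True
    let ?c = "- h k b / of_real (x k)"
    have Sb: "(\<lambda>u. (u, b)) -` S \<in> sets ?Q"
      using Sm by (rule sets_Pair2)
    have "emeasure (distr M ?Q U) ((\<lambda>u. (u, b)) -` S) = emeasure M (U -` ((\<lambda>u. (u, b)) -` S) \<inter> space M)"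
      by (rule emeasure_distr[OF U Sb])
    also have "\<dots> \<le> emeasure M {\<omega>\<in>space M. \<zeta> k \<omega> \<in> cball ?c (r k / x k)}"
    proof (rule emeasure_mono)
      show "U -` ((\<lambda>u. (u, b)) -` S) \<inter> space M \<subseteq> {\<omega>\<in>space M. \<zeta> k \<omega> \<in> cball ?c (r k / x k)}"
      proof
        fix \<omega> assume \<omega>: "\<omega> \<in> U -` ((\<lambda>u. (u, b)) -` S) \<inter> space M"
        let ?z = "\<zeta> k \<omega>"
        from \<omega> have le: "cmod (of_real (x k) * ?z + h k b) \<le> r k" by (simp add: S_def U_def)
        have "of_real (x k) * ?z + h k b = of_real (x k) * (?z - ?c)"
          using x[of k] by (simp add: field_simps)
        then have "cmod (of_real (x k) * ?z + h k b) = x k * cmod (?z - ?c)"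
          using x[of k] by (simp add: norm_mult)
        then have "cmod (?z - ?c) \<le> r k / x k"
          using le x[of k] by (simp add: field_simps)
        then have "?z \<in> cball ?c (r k / x k)"
          by (simp only: mem_cball dist_norm norm_minus_commute)
        with \<omega> show "\<omega> \<in> {\<omega>\<in>space M. \<zeta> k \<omega> \<in> cball ?c (r k / x k)}" by blast
      qed
      show "{\<omega>\<in>space M. \<zeta> k \<omega> \<in> cball ?c (r k / x k)} \<in> events"
        using measurable_sets[OF measurable_coeff[of k], of "cball ?c (r k / x k)"]
        by (simp add: vimage_def Int_def conj_commute del: mem_cball)
    qed
    also have "\<dots> \<le> ennreal ((r k / x k)\<^sup>2)"
      unfolding emeasure_eq_measure using x[of k] r[of k]
      by (intro ennreal_leI prob_coeff_cball_le) simp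
    finally show ?thesis using True by simp
  next
    case False
    then have "(\<lambda>u. (u, b)) -` S = {}" by (auto simp: S_def)
    then show ?thesis by simp
  qed
  have "emeasure M {\<omega>\<in>space M. (U \<omega>, W \<omega>) \<in> S}
      = emeasure (distr M ?N (\<lambda>\<omega>. (U \<omega>, W \<omega>))) S"
    by (subst emeasure_distr[OF measurable_Pair[OF U W] Sm]) (auto intro!: arg_cong[where f="emeasure M"])
  also have "\<dots> = emeasure (distr M ?Q U \<Otimes>\<^sub>M distr M (?P (Suc k)) W) S"
    using ind unfolding indep_var_distribution_eq by simp
  also have "\<dots> = (\<integral>\<^sup>+b. emeasure (distr M ?Q U) ((\<lambda>u. (u, b)) -` S) \<partial>distr M (?P (Suc k)) W)"
  proof -
    interpret pair_sigma_finite "distr M ?Q U" "distr M (?P (Suc k)) W" ..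
    show ?thesis
      using Sm by (intro emeasure_pair_measure_alt2) (simp cong: sets_pair_measure_cong)
  qed
  also have "\<dots> \<le> (\<integral>\<^sup>+b. ennreal ((r k / x k)\<^sup>2) * indicator B b \<partial>distr M (?P (Suc k)) W)"
    by (intro nn_integral_mono) (use slice in simp)
  also have "\<dots> = ennreal ((r k / x k)\<^sup>2) * emeasure (distr M (?P (Suc k)) W) B"
    using Bm by (subst nn_integral_cmult_indicator) auto
  also have "emeasure (distr M (?P (Suc k)) W) B = emeasure M {\<omega>\<in>space M. W \<omega> \<in> B}"
    by (subst emeasure_distr[OF W Bm]) (auto intro!: arg_cong[where f="emeasure M"])
  finally have main: "prob {\<omega>\<in>space M. (U \<omega>, W \<omega>) \<in> S} \<le> (r k / x k)\<^sup>2 * prob {\<omega>\<in>space M. W \<omega> \<in> B}"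
    by (simp add: emeasure_eq_measure flip: ennreal_mult')
  have Usp: "U \<omega> \<in> space ?Q" if "\<omega> \<in> space M" for \<omega>
    using measurable_space[OF U that] .
  have Wsp: "W \<omega> \<in> space (?P (Suc k))" if "\<omega> \<in> space M" for \<omega>
    using measurable_space[OF W that] .
  have res: "restrict (W \<omega>) {Suc i..} = restrict (\<lambda>j. \<zeta> j \<omega>) {Suc i..}" if "k \<le> i" for i \<omega>
    using that by (auto simp: W_def restrict_def)
  have WB: "{\<omega>\<in>space M. W \<omega> \<in> B} = {\<omega>\<in>space M. \<forall>i\<in>{Suc k..<n}.
            cmod (of_real (x i) * \<zeta> i \<omega> + h i (restrict (\<lambda>j. \<zeta> j \<omega>) {Suc i..})) \<le> r i}"
  proof (intro Collect_cong conj_cong refl)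
    fix \<omega> assume \<omega>: "\<omega> \<in> space M"
    have "W \<omega> i = \<zeta> i \<omega>" if "i \<in> {Suc k..<n}" for i
      using that by (simp add: W_def)
    then show "W \<omega> \<in> B \<longleftrightarrow> (\<forall>i\<in>{Suc k..<n}.
            cmod (of_real (x i) * \<zeta> i \<omega> + h i (restrict (\<lambda>j. \<zeta> j \<omega>) {Suc i..})) \<le> r i)"
      unfolding B_def mem_Collect_eq using Wsp[OF \<omega>] res by (intro iffI conjI ballI) (auto simp: res)
  qed
  have split: "{k..<n} = insert k {Suc k..<n}"
    using step.hyps by auto
  have "{\<omega>\<in>space M. \<forall>i\<in>{k..<n}.
            cmod (of_real (x i) * \<zeta> i \<omega> + h i (restrict (\<lambda>j. \<zeta> j \<omega>) {Suc i..})) \<le> r i}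
      = {\<omega>\<in>space M. W \<omega> \<in> B} \<inter> {\<omega>\<in>space M. cmod (of_real (x k) * \<zeta> k \<omega> + h k (W \<omega>)) \<le> r k}"
    unfolding WB split unfolding W_def by blast
  also have "\<dots> = {\<omega>\<in>space M. (U \<omega>, W \<omega>) \<in> S}"
    using Wsp Usp by (auto simp: S_def space_pair_measure U_def)
  finally have "prob {\<omega>\<in>space M. \<forall>i\<in>{k..<n}.
            cmod (of_real (x i) * \<zeta> i \<omega> + h i (restrict (\<lambda>j. \<zeta> j \<omega>) {Suc i..})) \<le> r i}
      \<le> (r k / x k)\<^sup>2 * prob {\<omega>\<in>space M. W \<omega> \<in> B}"
    using main by simp
  also have "\<dots> \<le> (r k / x k)\<^sup>2 * (\<Prod>i\<in>{Suc k..<n}. (r i / x i)\<^sup>2)"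
    unfolding WB by (intro mult_left_mono step.IH) auto
  also have "\<dots> = (\<Prod>i\<in>{k..<n}. (r i / x i)\<^sup>2)"
    unfolding split by simp
  finally show ?case .
qed

end

section \<open>Points of small product separation\<close>

text \<open>
  The points counted in the theorem, with an arbitrary set in place of the zero set: monotonicity and
  stability are properties of finite sets of points.
\<close>
definition close_points :: "real \<Rightarrow> real \<Rightarrow> complex set \<Rightarrow> complex set" where
  "close_points \<tau> \<sigma> X = {z \<in> ball 0 \<tau> \<inter> X. (\<Prod>w \<in> (ball z 1 \<inter> X) - {z}. cmod (z - w)) < \<sigma>}"

text \<open>
  Only zeros in the slightly larger disc matter. It is taken closed so that its intersections with
  closed discs are compact, which makes meeting the zero set a measurable event.
\<close>
lemma close_points_zeros:
  "close_points \<tau> \<sigma> (cball 0 (\<tau> + 1) \<inter> GEF_zeros L a) = {z \<in> ball 0 \<tau> \<inter> GEF_zeros L a. prod_sep L a z < \<sigma>}"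
proof -
  have "ball z 1 \<subseteq> cball 0 (\<tau> + 1) \<and> z \<in> cball 0 (\<tau> + 1)" if "z \<in> ball 0 \<tau>" for z :: complex
  proof -
    have "ball z 1 \<subseteq> ball 0 (\<tau> + 1)"
    proof
      fix w assume "w \<in> ball z 1"
      then show "w \<in> ball 0 (\<tau> + 1)"
        using that norm_triangle_ineq[of z "w - z"] by (simp add: dist_norm norm_minus_commute)
    qed
    then show ?thesis using that ball_subset_cball by force
  qed
  then have "ball z 1 \<inter> (cball 0 (\<tau> + 1) \<inter> GEF_zeros L a) = ball z 1 \<inter> GEF_zeros L a"
     "z \<in> cball 0 (\<tau> + 1)"
    if "z \<in> ball 0 \<tau>" for z using that by blast+
  then show ?thesis
    unfolding close_points_def prod_sep_def by auto
qed

lemma prod_dist_antimono: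
  assumes "finite B" "A \<subseteq> B" "\<And>w. w \<in> B - A \<Longrightarrow> cmod (z - w) \<le> 1"
  shows "(\<Prod>w\<in>B. cmod (z - w)) \<le> (\<Prod>w\<in>A. cmod (z - w))"
proof -
  have "(\<Prod>w\<in>B. cmod (z - w)) = (\<Prod>w\<in>B - A. cmod (z - w)) * (\<Prod>w\<in>A. cmod (z - w))"
    by (rule prod.subset_diff[OF assms(2,1)])
  also have "\<dots> \<le> 1 * (\<Prod>w\<in>A. cmod (z - w))"
    by (intro mult_right_mono prod_le_1 prod_nonneg) (use assms(3) in auto)
  finally show ?thesis by simp
qed

text \<open>
  Adding points only adds factors below \<open>1\<close> to the products.
\<close>
lemma close_points_mono:
  assumes "finite Y" "X \<subseteq> Y"
  shows "close_points \<tau> \<sigma> X \<subseteq> close_points \<tau> \<sigma> Y"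
proof
  fix z assume z: "z \<in> close_points \<tau> \<sigma> X"
  have "(\<Prod>w\<in>ball z 1 \<inter> Y - {z}. cmod (z - w)) \<le> (\<Prod>w\<in>ball z 1 \<inter> X - {z}. cmod (z - w))"
    by (rule prod_dist_antimono) (use assms in \<open>auto simp: dist_norm\<close>)
  with z assms show "z \<in> close_points \<tau> \<sigma> Y"
    by (auto simp: close_points_def)
qed

text \<open>
  All inequalities that make a point a close point are strict, so they survive small displacements.
  A displacement may bring further points within distance \<open>1\<close>, but these only lower the product.
\<close>
lemma close_points_stable:
  assumes X: "finite X"
  shows "\<exists>\<delta>>0. \<forall>h. (\<forall>z\<in>X. dist (h z) z < \<delta>) \<longrightarrow>
    card (close_points \<tau> \<sigma> X) \<le> card (close_points \<tau> \<sigma> (h ` X))"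
proof (rule ccontr)
  assume "\<not> ?thesis"
  then have "\<forall>n. \<exists>h. (\<forall>z\<in>X. dist (h z) z < inverse (real (Suc n))) \<and>
    \<not> card (close_points \<tau> \<sigma> X) \<le> card (close_points \<tau> \<sigma> (h ` X))"
    by (metis inverse_positive_iff_positive of_nat_0_less_iff zero_less_Suc)
  then obtain h where h: "\<And>n z. z \<in> X \<Longrightarrow> dist (h n z) z < inverse (real (Suc n))"
    and bad: "\<And>n. \<not> card (close_points \<tau> \<sigma> X) \<le> card (close_points \<tau> \<sigma> (h n ` X))"
    by metis
  let ?G = "close_points \<tau> \<sigma> X"
  have G: "?G \<subseteq> X" "finite ?G"
    using X by (auto simp: close_points_def)
  have lim: "(\<lambda>n. h n z) \<longlonglongrightarrow> z" if "z \<in> X" for z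
    by (rule metric_tendsto_imp_tendsto[OF LIMSEQ_inverse_real_of_nat])
       (use h[OF that] in \<open>auto intro!: always_eventually less_imp_le simp: dist_real_def\<close>)
  have e1: "\<forall>\<^sub>F n in sequentially. \<forall>z\<in>X. \<forall>w\<in>X. z \<noteq> w \<longrightarrow> h n z \<noteq> h n w"
  proof (intro eventually_ball_finite X ballI)
    fix z w assume "z \<in> X" "w \<in> X"
    show "\<forall>\<^sub>F n in sequentially. z \<noteq> w \<longrightarrow> h n z \<noteq> h n w"
    proof (cases "z = w")
      case False
      have "(\<lambda>n. dist (h n z) (h n w)) \<longlonglongrightarrow> dist z w"
        by (intro tendsto_dist lim) fact+
      from order_tendstoD(1)[OF this, of 0] False show ?thesis
        by (auto elim!: eventually_mono)
    qed simp
  qed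
  have e2: "\<forall>\<^sub>F n in sequentially. \<forall>z\<in>?G. cmod (h n z) < \<tau>"
  proof (intro eventually_ball_finite G ballI)
    fix z assume z: "z \<in> ?G"
    have "(\<lambda>n. cmod (h n z)) \<longlonglongrightarrow> cmod z"
      using z G by (intro tendsto_norm lim) auto
    from order_tendstoD(2)[OF this] z show "\<forall>\<^sub>F n in sequentially. cmod (h n z) < \<tau>"
      by (auto simp: close_points_def)
  qed
  have e3: "\<forall>\<^sub>F n in sequentially. \<forall>z\<in>X. \<forall>w\<in>X. dist z w < 1 \<longrightarrow> dist (h n z) (h n w) < 1"
  proof (intro eventually_ball_finite X ballI)
    fix z w assume "z \<in> X" "w \<in> X"
    then have "(\<lambda>n. dist (h n z) (h n w)) \<longlonglongrightarrow> dist z w"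
      by (intro tendsto_dist lim)
    from order_tendstoD(2)[OF this, of 1]
    show "\<forall>\<^sub>F n in sequentially. dist z w < 1 \<longrightarrow> dist (h n z) (h n w) < 1"
      by (cases "dist z w < 1") (auto elim!: eventually_mono)
  qed
  have e4: "\<forall>\<^sub>F n in sequentially. \<forall>z\<in>?G. (\<Prod>w\<in>ball z 1 \<inter> X - {z}. cmod (h n z - h n w)) < \<sigma>"
  proof (intro eventually_ball_finite G ballI)
    fix z assume z: "z \<in> ?G"
    have "(\<lambda>n. \<Prod>w\<in>ball z 1 \<inter> X - {z}. cmod (h n z - h n w))
        \<longlonglongrightarrow> (\<Prod>w\<in>ball z 1 \<inter> X - {z}. cmod (z - w))"
      using z G by (intro tendsto_prod tendsto_norm tendsto_diff lim) auto
    from order_tendstoD(2)[OF this] z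
    show "\<forall>\<^sub>F n in sequentially. (\<Prod>w\<in>ball z 1 \<inter> X - {z}. cmod (h n z - h n w)) < \<sigma>"
      by (auto simp: close_points_def)
  qed
  have "\<forall>\<^sub>F n in sequentially. card ?G \<le> card (close_points \<tau> \<sigma> (h n ` X))"
    using e1 e2 e3 e4
  proof eventually_elim
    case (elim n)
    have inj: "inj_on (h n) X"
      using elim(1) by (auto simp: inj_on_def)
    have "h n ` ?G \<subseteq> close_points \<tau> \<sigma> (h n ` X)"
    proof
      fix v assume "v \<in> h n ` ?G"
      then obtain z where z: "z \<in> ?G" "v = h n z" by blast
      have zX: "z \<in> X" using z G by blast
      have sub: "h n ` (ball z 1 \<inter> X - {z}) \<subseteq> ball v 1 \<inter> h n ` X - {v}"
        using elim(1,3) zX z(2) by auto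
      have "(\<Prod>w\<in>ball v 1 \<inter> h n ` X - {v}. cmod (v - w))
          \<le> (\<Prod>w\<in>h n ` (ball z 1 \<inter> X - {z}). cmod (v - w))"
        using X sub by (intro prod_dist_antimono) (auto simp: dist_norm)
      also have "\<dots> = (\<Prod>w\<in>ball z 1 \<inter> X - {z}. cmod (h n z - h n w))"
        unfolding z(2) by (subst prod.reindex) (auto intro: inj_on_subset[OF inj])
      also have "\<dots> < \<sigma>" using elim(4) z(1) by blast
      finally show "v \<in> close_points \<tau> \<sigma> (h n ` X)"
        using elim(2) z zX by (auto simp: close_points_def)
    qed
    then have "card (h n ` ?G) \<le> card (close_points \<tau> \<sigma> (h n ` X))"
      using X by (intro card_mono) (auto simp: close_points_def)
    then show ?case
      using card_image[OF inj_on_subset[OF inj G(1)]] by simp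
  qed
  then show False
    using bad eventually_happens' sequentially_bot by blast
qed

text \<open>
  For countable \<open>D\<close>, the right-hand side is a countable combination of conditions that \<open>X\<close> meets a
  given closed disc. It is sufficient by monotonicity, and necessary by stability with respect to
  displacements by less than twice the radius of the discs.
\<close>
lemma ex_close_configuration:
  assumes X: "finite X" and D: "\<And>U. open U \<Longrightarrow> U \<noteq> {} \<Longrightarrow> \<exists>d\<in>D. d \<in> (U :: complex set)"
  shows "k \<le> card (close_points \<tau> \<sigma> X) \<longleftrightarrow>
    (\<exists>n. \<exists>F\<in>{F. finite F \<and> F \<subseteq> D}.
       (\<forall>f. (\<forall>x\<in>F. f x \<in> cball x (inverse (Suc n))) \<longrightarrow> k \<le> card (close_points \<tau> \<sigma> (f ` F))) \<and>
       (\<forall>x\<in>F. cball x (inverse (Suc n)) \<inter> X \<noteq> {}))" (is "?L \<longleftrightarrow> ?R")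
proof
  assume ?R
  then obtain n F where F: "finite F"
    and good: "\<And>f. (\<forall>x\<in>F. f x \<in> cball x (inverse (Suc n))) \<Longrightarrow> k \<le> card (close_points \<tau> \<sigma> (f ` F))"
    and hit: "\<forall>x\<in>F. cball x (inverse (Suc n)) \<inter> X \<noteq> {}" by blast
  from hit have "\<forall>x\<in>F. \<exists>z. z \<in> cball x (inverse (Suc n)) \<and> z \<in> X" by blast
  then obtain f where f: "\<forall>x\<in>F. f x \<in> cball x (inverse (Suc n)) \<and> f x \<in> X" by metis
  then have "k \<le> card (close_points \<tau> \<sigma> (f ` F))" using good by blast
  also have "\<dots> \<le> card (close_points \<tau> \<sigma> X)"
    using f X by (intro card_mono close_points_mono) (auto simp: close_points_def)
  finally show ?L .
next
  assume ?L
  obtain \<delta> where \<delta>: "\<delta> > 0" "\<And>h. (\<forall>z\<in>X. dist (h z) z < \<delta>) \<Longrightarrow>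
    card (close_points \<tau> \<sigma> X) \<le> card (close_points \<tau> \<sigma> (h ` X))"
    using close_points_stable[OF X] by metis
  obtain n where n: "inverse (real (Suc n)) < \<delta> / 2"
    using reals_Archimedean[of "\<delta> / 2"] \<delta>(1) by auto
  have "\<exists>d. d \<in> D \<and> dist d z < inverse (Suc n)" for z
    using D[of "ball z (inverse (real (Suc n)))"] by (auto simp: dist_commute)
  then obtain q where q: "\<And>z. q z \<in> D" "\<And>z. dist (q z) z < inverse (Suc n)" by metis
  have "k \<le> card (close_points \<tau> \<sigma> (f ` q ` X))" if f: "\<forall>x\<in>q ` X. f x \<in> cball x (inverse (Suc n))" for f
  proof -
    have "dist (f (q z)) z < \<delta>" if "z \<in> X" for z
      using f that q(2)[of z] n dist_triangle[of "f (q z)" z "q z"] by (force simp: dist_commute)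
    then have "card (close_points \<tau> \<sigma> X) \<le> card (close_points \<tau> \<sigma> ((\<lambda>z. f (q z)) ` X))"
      by (intro \<delta>(2)) auto
    with \<open>?L\<close> show ?thesis by (simp add: image_image)
  qed
  moreover have "\<forall>x\<in>q ` X. cball x (inverse (Suc n)) \<inter> X \<noteq> {}"
    using q(2) by (force intro: less_imp_le)
  ultimately show ?R
    using X q(1) by (intro exI[of _ n] bexI[of _ "q ` X"]) auto
qed

lemma prod_ordered_pairs:
  fixes g :: "nat \<Rightarrow> nat \<Rightarrow> real"
  assumes sym: "\<And>i s. g i s = g s i"
  shows "(\<Prod>i<n. (\<Prod>s\<in>{i<..<n}. g i s)\<^sup>2) = (\<Prod>i<n. \<Prod>s\<in>{..<n}-{i}. g i s)"
proof (induction n)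
  case (Suc n)
  have "(\<Prod>i<Suc n. (\<Prod>s\<in>{i<..<Suc n}. g i s)\<^sup>2) = (\<Prod>i<n. ((\<Prod>s\<in>{i<..<n}. g i s) * g i n)\<^sup>2)"
  proof -
    have "{i<..<Suc n} = insert n {i<..<n}" if "i < n" for i using that by auto
    moreover have "{n<..<Suc n} = {}" by auto
    ultimately show ?thesis by (simp add: mult.commute)
  qed
  also have "\<dots> = (\<Prod>i<n. (\<Prod>s\<in>{i<..<n}. g i s)\<^sup>2) * (\<Prod>i<n. g i n) * (\<Prod>i<n. g i n)"
    by (simp add: prod.distrib power2_eq_square mult_ac)
  also have "\<dots> = (\<Prod>i<n. \<Prod>s\<in>{..<n}-{i}. g i s) * (\<Prod>i<n. g i n) * (\<Prod>i<n. g n i)"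
    unfolding Suc.IH using sym by simp
  also have "\<dots> = (\<Prod>i<Suc n. \<Prod>s\<in>{..<Suc n}-{i}. g i s)"
  proof -
    have "{..<Suc n} - {i} = insert n ({..<n} - {i})" if "i < n" for i using that by auto
    moreover have "{..<Suc n} - {n} = {..<n}" by auto
    ultimately show ?thesis by (simp add: prod.distrib mult_ac)
  qed
  finally show ?case .
qed simp

text \<open>
  The inner product over the points within distance \<open>1\<close> of \<open>z\<close> is the product separation: it is at most
  \<open>\<sigma>\<close> at a close point, and at most \<open>1\<close> elsewhere. All other distances are at most \<open>2 R\<close>.
\<close>
lemma prod_dist_close_points_le:
  assumes X: "finite X" "X \<subseteq> cball 0 R" and "R \<ge> 1" "0 < \<sigma>" "\<sigma> \<le> 1"
    and k: "k \<le> card (close_points \<tau> \<sigma> X)"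
  shows "(\<Prod>z\<in>X. \<Prod>w\<in>X-{z}. cmod (z - w)) \<le> \<sigma> ^ k * (2 * R) ^ (card X)\<^sup>2"
proof -
  let ?G = "close_points \<tau> \<sigma> X"
  have far: "(\<Prod>w\<in>X-{z}-ball z 1. cmod (z - w)) \<le> (2 * R) ^ card X" if "z \<in> X" for z
  proof -
    have "(\<Prod>w\<in>X-{z}-ball z 1. cmod (z - w)) \<le> (\<Prod>w\<in>X-{z}-ball z 1. 2 * R)"
    proof (intro prod_mono conjI)
      fix w assume "w \<in> X - {z} - ball z 1"
      then have "cmod w \<le> R" "cmod z \<le> R" using X that by auto
      then show "cmod (z - w) \<le> 2 * R" using norm_triangle_ineq4[of z w] by simp
    qed simp
    also have "\<dots> \<le> (2 * R) ^ card X"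
      unfolding prod_constant using X(1) \<open>R \<ge> 1\<close> by (intro power_increasing card_mono) auto
    finally show ?thesis .
  qed
  have one: "(\<Prod>w\<in>X-{z}. cmod (z - w)) \<le> (if z \<in> ?G then \<sigma> else 1) * (2 * R) ^ card X" if z: "z \<in> X" for z
  proof -
    have eq: "X - {z} = (ball z 1 \<inter> X - {z}) \<union> (X - {z} - ball z 1)" by blast
    have "(\<Prod>w\<in>X-{z}. cmod (z - w))
       = (\<Prod>w\<in>ball z 1 \<inter> X - {z}. cmod (z - w)) * (\<Prod>w\<in>X-{z}-ball z 1. cmod (z - w))"
      using X(1) by (subst eq, intro prod.union_disjoint) auto
    also have "\<dots> \<le> (if z \<in> ?G then \<sigma> else 1) * (2 * R) ^ card X"
    proof (rule mult_mono[OF _ far[OF z]])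
      have "(\<Prod>w\<in>ball z 1 \<inter> X - {z}. cmod (z - w)) \<le> 1"
        by (rule prod_le_1) (auto simp: dist_norm)
      then show "(\<Prod>w\<in>ball z 1 \<inter> X - {z}. cmod (z - w)) \<le> (if z \<in> ?G then \<sigma> else 1)"
        by (auto simp: close_points_def)
    qed (use \<open>0 < \<sigma>\<close> in \<open>auto intro: prod_nonneg\<close>)
    finally show ?thesis .
  qed
  have "(\<Prod>z\<in>X. \<Prod>w\<in>X-{z}. cmod (z - w)) \<le> (\<Prod>z\<in>X. (if z \<in> ?G then \<sigma> else 1) * (2 * R) ^ card X)"
    by (intro prod_mono conjI prod_nonneg one) auto
  also have "\<dots> = (\<Prod>z\<in>X. if z \<in> ?G then \<sigma> else 1) * (2 * R) ^ (card X)\<^sup>2"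
    unfolding prod.distrib prod_constant power_mult[symmetric] power2_eq_square ..
  also have "(\<Prod>z\<in>X. if z \<in> ?G then \<sigma> else 1) = \<sigma> ^ card ?G"
  proof -
    have "?G = X \<inter> ?G" by (auto simp: close_points_def)
    then show ?thesis
      using X(1) by (simp add: prod.If_cases)
  qed
  also have "\<sigma> ^ card ?G * (2 * R) ^ (card X)\<^sup>2 \<le> \<sigma> ^ k * (2 * R) ^ (card X)\<^sup>2"
    using assms by (intro mult_right_mono power_decreasing) auto
  finally show ?thesis .
qed

section \<open>Measurability\<close>

context iid_complex_normal
begin

lemma sets_tempered [measurable]: "{\<omega>\<in>space M. tempered t (\<lambda>n. \<zeta> n \<omega>)} \<in> sets M"
  unfolding tempered_def by measurable

lemma prob_not_tempered:
  "prob {\<omega>\<in>space M. \<not> tempered t (\<lambda>n. \<zeta> n \<omega>)} \<le> exp (- t\<^sup>2) / 4"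
proof -
  let ?A = "\<lambda>j. {\<omega>\<in>space M. (cmod (\<zeta> j \<omega>))\<^sup>2 > 2 * t\<^sup>2 + 2 * real j + 6}"
  let ?b = "\<lambda>j. 2 * exp (- t\<^sup>2 - 3) * exp (-1) ^ j :: real"
  have e2: "exp (-1 :: real) \<le> 1 / 2"
    using exp_ge_add_one_self[of "1::real"] by (simp add: exp_minus field_simps)
  have sums: "?b sums (2 * exp (- t\<^sup>2 - 3) * (1 / (1 - exp (-1))))"
    by (intro sums_mult geometric_sums) simp
  have A: "prob (?A j) \<le> ?b j" for j
  proof -
    have "prob (?A j) \<le> 2 * exp (- (2 * t\<^sup>2 + 2 * real j + 6) / 2)"
      by (rule prob_coeff_tail)
    also have "exp (- (2 * t\<^sup>2 + 2 * real j + 6) / 2) = exp (- t\<^sup>2 - 3) * exp (-1) ^ j"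
      by (simp add: field_simps flip: exp_of_nat_mult exp_add)
    finally show ?thesis by simp
  qed
  have Am: "?A j \<in> events" for j by measurable
  have sA: "summable (\<lambda>j. prob (?A j))"
    by (rule summable_comparison_test'[OF sums_summable[OF sums], of 0]) (use A in auto)
  have "{\<omega>\<in>space M. \<not> tempered t (\<lambda>n. \<zeta> n \<omega>)} = (\<Union>j. ?A j)"
    by (auto simp: tempered_def not_le)
  then have "prob {\<omega>\<in>space M. \<not> tempered t (\<lambda>n. \<zeta> n \<omega>)} \<le> (\<Sum>j. prob (?A j))"
    using finite_measure_subadditive_countably[of ?A, OF _ sA] Am by force
  also have "\<dots> \<le> (\<Sum>j. ?b j)"
    by (rule suminf_le[OF A sA sums_summable[OF sums]])
  also have "\<dots> = 2 * exp (- t\<^sup>2 - 3) * (1 / (1 - exp (-1)))"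
    by (rule sums_unique[OF sums, symmetric])
  also have "\<dots> \<le> 2 * exp (- t\<^sup>2 - 3) * 2"
    using e2 by (intro mult_left_mono) (auto simp: field_simps)
  also have "\<dots> = 4 * exp (-3) * exp (- t\<^sup>2)"
    by (simp add: mult.commute mult_exp_exp)
  also have "\<dots> \<le> 4 * (1 / 16) * exp (- t\<^sup>2)"
  proof -
    have "16 \<le> exp (3::real)"
    proof -
      have "2 \<le> exp (3 / 4 :: real)"
        using exp_lower_Taylor_quadratic[of "3 / 4 :: real"] by (simp add: power2_eq_square)
      then have "2 ^ 4 \<le> exp (3 / 4 :: real) ^ 4" by (intro power_mono) auto
      then show ?thesis by (simp flip: exp_of_nat_mult)
    qed
    then show ?thesis by (intro mult_right_mono) (simp_all add: exp_minus field_simps)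
  qed
  finally show ?thesis by simp
qed

text \<open>
  Here the series is a non-zero entire function, so its zeros are locally finite.
\<close>
definition regular_outcomes :: "'a set" where
  "regular_outcomes = {\<omega>\<in>space M. (\<exists>n::nat. tempered (real n) (\<lambda>j. \<zeta> j \<omega>)) \<and> \<zeta> 0 \<omega> \<noteq> 0}"

lemma sets_regular_outcomes [measurable]: "regular_outcomes \<in> sets M"
  unfolding regular_outcomes_def by measurable

lemma null_nonregular: "space M - regular_outcomes \<in> null_sets M"
proof -
  have "prob {\<omega>\<in>space M. \<forall>n::nat. \<not> tempered (real n) (\<lambda>j. \<zeta> j \<omega>)} = 0" (is "prob ?N = 0")
  proof (rule antisym[OF LIMSEQ_le_const])
    show "(\<lambda>n. exp (- real n) / 4) \<longlonglongrightarrow> 0"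
      by real_asymp
    have "prob ?N \<le> exp (- real n) / 4" for n
    proof -
      have "prob ?N \<le> prob {\<omega>\<in>space M. \<not> tempered (real n) (\<lambda>j. \<zeta> j \<omega>)}"
        by (intro finite_measure_mono) auto
      also have "\<dots> \<le> exp (- (real n)\<^sup>2) / 4"
        by (rule prob_not_tempered)
      also have "\<dots> \<le> exp (- real n) / 4"
      proof -
        have "n \<le> n * n" by (cases n) auto
        then have "real n \<le> (real n)\<^sup>2" by (metis of_nat_le_iff of_nat_mult power2_eq_square)
        then show ?thesis by simp
      qed
      finally show ?thesis .
    qed
    then show "\<exists>N. \<forall>n\<ge>N. prob ?N \<le> exp (- real n) / 4" by blast
  qed simp
  moreover have "prob {\<omega>\<in>space M. \<zeta> 0 \<omega> \<in> cball 0 0} = 0"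
    using prob_coeff_cball_le[of 0 0 0] by (simp add: antisym)
  ultimately have "?N \<in> null_sets M" "{\<omega>\<in>space M. \<zeta> 0 \<omega> \<in> cball 0 0} \<in> null_sets M"
    by (auto simp: null_sets_def emeasure_eq_measure)
  then have "?N \<union> {\<omega>\<in>space M. \<zeta> 0 \<omega> \<in> cball 0 0} \<in> null_sets M"
    by (rule null_sets.Un)
  moreover have "space M - regular_outcomes = ?N \<union> {\<omega>\<in>space M. \<zeta> 0 \<omega> \<in> cball 0 0}"
    by (auto simp: regular_outcomes_def)
  ultimately show ?thesis by simp
qed

lemma measurable_GEF [measurable]: "(\<lambda>\<omega>. GEF L (\<lambda>n. \<zeta> n \<omega>) z) \<in> borel_measurable M"
  unfolding GEF_def by measurable

text \<open>
  A continuous function has a zero in a compact set if and only if it takes arbitrarily small values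
  on a countable dense subset.
\<close>
lemma sets_GEF_zero_in_compact:
  assumes "L > 0" "compact K"
  shows "{\<omega>\<in>regular_outcomes. K \<inter> GEF_zeros L (\<lambda>n. \<zeta> n \<omega>) \<noteq> {}} \<in> sets M"
proof -
  obtain D where D: "countable D" "D \<subseteq> K" "K \<subseteq> closure D"
    using separable[of K] by metis
  have iff: "K \<inter> GEF_zeros L (\<lambda>n. \<zeta> n \<omega>) \<noteq> {} \<longleftrightarrow>
    (\<forall>n. \<exists>q\<in>D. cmod (GEF L (\<lambda>n. \<zeta> n \<omega>) q) < inverse (Suc n))" if \<omega>: "\<omega> \<in> regular_outcomes" for \<omega>
  proof -
    let ?F = "GEF L (\<lambda>n. \<zeta> n \<omega>)"
    obtain t where t: "tempered (real t) (\<lambda>j. \<zeta> j \<omega>)"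
      using \<omega> by (auto simp: regular_outcomes_def)
    have cont: "continuous_on UNIV ?F"
      by (rule holomorphic_on_imp_continuous_on[OF GEF_holomorphic[OF t _ \<open>L > 0\<close>]]) simp
    show ?thesis
    proof
      assume "K \<inter> GEF_zeros L (\<lambda>n. \<zeta> n \<omega>) \<noteq> {}"
      then obtain z where z: "z \<in> K" "?F z = 0" by (auto simp: GEF_zeros_def)
      show "\<forall>n. \<exists>q\<in>D. cmod (?F q) < inverse (Suc n)"
      proof
        fix n
        have "open (?F -` ball 0 (inverse (Suc n)))"
          using cont by (simp add: continuous_on_eq_continuous_within open_vimage)
        moreover have "z \<in> ?F -` ball 0 (inverse (Suc n))" using z by simp
        moreover have "z \<in> closure D" using z D by blast
        ultimately have "D \<inter> ?F -` ball 0 (inverse (Suc n)) \<noteq> {}"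
          by (metis closure_iff_nhds_not_empty inf_commute subset_refl)
        then show "\<exists>q\<in>D. cmod (?F q) < inverse (Suc n)" by auto
      qed
    next
      assume "\<forall>n. \<exists>q\<in>D. cmod (?F q) < inverse (Suc n)"
      then obtain q where q: "\<And>n. q n \<in> D" "\<And>n. cmod (?F (q n)) < inverse (Suc n)" by metis
      have "\<And>n. q n \<in> K" using q D by blast
      then obtain l s where ls: "l \<in> K" "strict_mono s" "(q \<circ> s) \<longlonglongrightarrow> l"
        using \<open>compact K\<close> unfolding compact_def by metis
      have "(\<lambda>n. ?F (q n)) \<longlonglongrightarrow> 0"
        by (rule metric_tendsto_imp_tendsto[OF LIMSEQ_inverse_real_of_nat])
           (use q(2) in \<open>auto intro!: always_eventually less_imp_le\<close>)
      then have "(\<lambda>n. ?F ((q \<circ> s) n)) \<longlonglongrightarrow> 0"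
        using LIMSEQ_subseq_LIMSEQ[OF _ ls(2), of "\<lambda>n. ?F (q n)"] by (simp add: o_def)
      moreover have "(\<lambda>n. ?F ((q \<circ> s) n)) \<longlonglongrightarrow> ?F l"
        by (rule isCont_tendsto_compose[OF _ ls(3)]) (use cont in \<open>simp add: continuous_on_eq_continuous_at\<close>)
      ultimately have "?F l = 0" using LIMSEQ_unique by blast
      then show "K \<inter> GEF_zeros L (\<lambda>n. \<zeta> n \<omega>) \<noteq> {}"
        using ls(1) by (auto simp: GEF_zeros_def)
    qed
  qed
  have "{\<omega>\<in>regular_outcomes. K \<inter> GEF_zeros L (\<lambda>n. \<zeta> n \<omega>) \<noteq> {}}
     = regular_outcomes \<inter> {\<omega>\<in>space M. \<forall>n. \<exists>q\<in>D. cmod (GEF L (\<lambda>n. \<zeta> n \<omega>) q) < inverse (Suc n)}"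
    using iff by (auto simp: regular_outcomes_def)
  also have "\<dots> \<in> sets M"
    by (intro sets.Int sets_regular_outcomes sets.sets_Collect_countable_All
        sets.sets_Collect_countable_Ex' D(1)) measurable
  finally show ?thesis .
qed

lemma finite_zeros_regular:
  assumes "\<omega> \<in> regular_outcomes" "L > 0"
  shows "finite (cball 0 r \<inter> GEF_zeros L (\<lambda>n. \<zeta> n \<omega>))"
proof -
  obtain t where "tempered (real t) (\<lambda>j. \<zeta> j \<omega>)" "\<zeta> 0 \<omega> \<noteq> 0"
    using assms(1) by (auto simp: regular_outcomes_def)
  then show ?thesis
    using assms(2) by (intro GEF_finite_zeros) auto
qed

lemma sets_many_close_zeros_regular:
  assumes "L > 0"
  shows "many_close_zeros M \<zeta> L \<tau> \<sigma> k \<inter> regular_outcomes \<in> sets M"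
proof -
  obtain D :: "complex set" where D: "countable D" "\<And>U. open U \<Longrightarrow> U \<noteq> {} \<Longrightarrow> \<exists>d\<in>D. d \<in> U"
    using countable_dense_setE by metis
  let ?B = "\<lambda>n x. cball x (inverse (Suc n)) \<inter> cball 0 (\<tau> + 1)"
  let ?Z = "\<lambda>\<omega>. GEF_zeros L (\<lambda>n. \<zeta> n \<omega>)"
  define good where "good n F \<longleftrightarrow> (\<forall>f. (\<forall>x\<in>F. f x \<in> cball x (inverse (Suc n))) \<longrightarrow>
    k \<le> card (close_points \<tau> \<sigma> (f ` F)))" for n :: nat and F
  have "many_close_zeros M \<zeta> L \<tau> \<sigma> k \<inter> regular_outcomes
     = {\<omega>\<in>regular_outcomes. k \<le> card (close_points \<tau> \<sigma> (cball 0 (\<tau> + 1) \<inter> ?Z \<omega>))}"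
    unfolding close_points_zeros by (auto simp: many_close_zeros_def regular_outcomes_def)
  also have "\<dots> = {\<omega>\<in>regular_outcomes. \<exists>n. \<exists>F\<in>{F. finite F \<and> F \<subseteq> D}. good n F \<and> (\<forall>x\<in>F. ?B n x \<inter> ?Z \<omega> \<noteq> {})}"
    using ex_close_configuration[OF finite_zeros_regular[OF _ \<open>L > 0\<close>] D(2)]
    by (intro Collect_cong conj_cong refl) (simp add: good_def Int_assoc)
  also have "\<dots> = (\<Union>n. \<Union>F\<in>{F. finite F \<and> F \<subseteq> D}. {\<omega>\<in>regular_outcomes. good n F \<and> (\<forall>x\<in>F. ?B n x \<inter> ?Z \<omega> \<noteq> {})})"
    by blast
  also have "\<dots> \<in> sets M"
  proof (rule sets.countable_UN''[OF countableI_type], rule sets.countable_UN''[OF countable_Collect_finite_subset[OF D(1)]])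
    fix n F assume "F \<in> {F. finite F \<and> F \<subseteq> D}"
    then have "finite F" by simp
    have "{\<omega>\<in>regular_outcomes. \<forall>x\<in>F. ?B n x \<inter> ?Z \<omega> \<noteq> {}}
       = regular_outcomes \<inter> {\<omega>\<in>space M. \<forall>x\<in>F. \<omega> \<in> {\<omega>\<in>regular_outcomes. ?B n x \<inter> ?Z \<omega> \<noteq> {}}}"
      by (auto simp: regular_outcomes_def)
    also have "\<dots> \<in> sets M"
    proof (rule sets.Int[OF sets_regular_outcomes sets.sets_Collect_finite_All[OF _ \<open>finite F\<close>]])
      fix x assume "x \<in> F"
      have A: "{\<omega>\<in>regular_outcomes. ?B n x \<inter> ?Z \<omega> \<noteq> {}} \<in> sets M" (is "?A \<in> _")
        by (rule sets_GEF_zero_in_compact[OF \<open>L > 0\<close>]) (intro compact_Int compact_cball)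
      have "{\<omega>\<in>space M. \<omega> \<in> ?A} = ?A"
        using sets.sets_into_space[OF A] by blast
      with A show "{\<omega>\<in>space M. \<omega> \<in> ?A} \<in> sets M"
        by (simp only:)
    qed
    finally show "{\<omega>\<in>regular_outcomes. good n F \<and> (\<forall>x\<in>F. ?B n x \<inter> ?Z \<omega> \<noteq> {})} \<in> sets M"
      by (cases "good n F") simp_all
  qed
  finally show ?thesis .
qed

end

section \<open>Coefficients forced to be small by overcrowding\<close>

context iid_complex_normal
begin

definition small_coeffs :: "real \<Rightarrow> 'a set" where
  "small_coeffs m = {\<omega>\<in>space M. \<forall>j\<in>{0..<nat \<lceil>m\<rceil>}. cmod (\<zeta> j \<omega>) \<le> exp (- m - 1)}"

lemma sets_small_coeffs [measurable]: "small_coeffs m \<in> sets M"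
  unfolding small_coeffs_def by measurable

text \<open>
  There are at least \<open>max m 1\<close> independent coefficients, each smaller than \<open>exp (- m - 1)\<close> with
  probability at most \<open>exp (- 2 (m + 1))\<close>.
\<close>
lemma prob_small_coeffs:
  assumes "m > 0"
  shows "prob (small_coeffs m) \<le> exp (- m\<^sup>2) / 2"
proof -
  let ?J = "nat \<lceil>m\<rceil>"
  have "prob (small_coeffs m) \<le> (\<Prod>j\<in>{0..<?J}. (exp (- m - 1) / 1)\<^sup>2)"
    using prob_triangular_le[of "\<lambda>_ _. 0" "\<lambda>_. 1" "\<lambda>_. exp (- m - 1)" 0 ?J]
    by (simp add: small_coeffs_def)
  also have "\<dots> = exp (- m - 1) ^ (2 * ?J)"
    by (simp add: power_mult)
  also have "\<dots> = exp (real (2 * ?J) * (- m - 1))"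
    by (rule exp_of_nat_mult[symmetric])
  also have "\<dots> \<le> exp (- m\<^sup>2 - 1)"
  proof -
    have "1 \<le> ?J" using assms by (simp add: Suc_le_eq)
    then have J: "m \<le> real ?J" "1 \<le> real ?J" using assms by linarith+
    have "m * m + 1 \<le> real ?J * m + real ?J"
      using J assms by (intro add_mono mult_right_mono) auto
    then have "- 2 * (real ?J * m + real ?J) \<le> - 2 * (m * m + 1)" by simp
    also have "\<dots> \<le> - (m * m) - 1" by simp
    finally have "- 2 * (real ?J * m + real ?J) \<le> - m\<^sup>2 - 1" by (simp add: power2_eq_square)
    moreover have "real (2 * ?J) * (- m - 1) = - 2 * (real ?J * m + real ?J)"
      by (simp add: algebra_simps)
    ultimately show ?thesis by (simp only: exp_le_cancel_iff)
  qed
  also have "\<dots> = exp (-1) * exp (- m\<^sup>2)" by (simp add: mult_exp_exp)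
  also have "\<dots> \<le> 1 / 2 * exp (- m\<^sup>2)"
    using exp_ge_add_one_self[of "1::real"]
    by (intro mult_right_mono) (simp_all add: exp_minus field_simps)
  finally show ?thesis by simp
qed

lemma crowded_imp_small_coeffs:
  assumes "\<omega> \<in> space M" "tempered m (\<lambda>j. \<zeta> j \<omega>)" "L > 0" "R > 0" "m = L * R\<^sup>2"
    and X: "finite X" "X \<subseteq> cball 0 R \<inter> GEF_zeros L (\<lambda>j. \<zeta> j \<omega>)" "max_zeros m \<le> card X"
  shows "\<omega> \<in> small_coeffs m"
proof -
  have m: "m > 0" using assms by simp
  have "cmod (\<zeta> j \<omega>) \<le> exp (- m - 1)" if "j < nat \<lceil>m\<rceil>" for j
  proof -
    have "cmod (\<zeta> j \<omega>) \<le> 6 * exp (197 * m) / 3 ^ card X"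
      using that by (intro crowded_coeff_le[OF assms(2-5) X(1,2)]) linarith
    also have "\<dots> \<le> 6 * exp (197 * m) / 3 ^ max_zeros m"
      using X(3) by (intro divide_left_mono) (auto intro: power_increasing)
    also have "\<dots> \<le> exp (- m - 1)" by (rule exp_3_power_max_zeros[OF m])
    finally show ?thesis .
  qed
  then show ?thesis using assms(1) by (simp add: small_coeffs_def)
qed

end

section \<open>Divided differences at points near the zeros\<close>

text \<open>
  The divided difference of \<open>z\<^sup>j\<close> is the coefficient of degree \<open>i\<close> of the Lagrange interpolation
  polynomial at \<open>y\<^sub>0, \<dots>, y\<^sub>i\<close>, which is \<open>z\<^sup>j\<close> itself as \<open>j \<le> i\<close>.
\<close>
lemma divided_difference_power:
  fixes y :: "nat \<Rightarrow> complex"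
  assumes inj: "inj_on y {..i}" and "j \<le> i"
  shows "(\<Sum>l\<le>i. y l ^ j / (\<Prod>s\<in>{..i}-{l}. y l - y s)) = (if j = i then 1 else 0)"
proof -
  define w where "w l = (\<Prod>s\<in>{..i}-{l}. y l - y s)" for l
  define P where "P l = (\<Prod>s\<in>{..i}-{l}. [:- y s, 1:])" for l
  define Q where "Q = (\<Sum>l\<le>i. smult (y l ^ j / w l) (P l))"
  have w0: "w l \<noteq> 0" if "l \<le> i" for l
    using that inj by (auto simp: w_def inj_on_def)
  have degP: "degree (P l) = i" if "l \<le> i" for l
    using that by (simp add: P_def degree_prod_eq_sum_degree)
  have leadP: "lead_coeff (P l) = 1" for l
    unfolding P_def lead_coeff_prod by simp
  have "degree Q \<le> i"
    unfolding Q_def by (intro degree_sum_le) (use degP in auto)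
  have polyP: "poly (P l) (y s) = (if s = l then w l else 0)" if "l \<le> i" "s \<le> i" for l s
  proof -
    have "poly (P l) (y s) = (\<Prod>t\<in>{..i}-{l}. y s - y t)"
      by (simp add: P_def poly_prod)
    then show ?thesis
      using that by (auto simp: w_def intro!: prod_zero)
  qed
  have "Q - monom 1 j = 0"
  proof (rule ccontr)
    assume nz: "Q - monom 1 j \<noteq> 0"
    have root: "poly (Q - monom 1 j) (y s) = 0" if "s \<le> i" for s
    proof -
      have "poly Q (y s) = (\<Sum>l\<le>i. if l = s then y s ^ j else 0)"
        unfolding Q_def poly_sum poly_smult
        by (intro sum.cong) (use polyP w0 that in auto)
      then show ?thesis
        using that by (simp add: poly_monom)
    qed
    have "Suc i = card (y ` {..i})"
      using inj by (simp add: card_image)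
    also have "\<dots> \<le> card {x. poly (Q - monom 1 j) x = 0}"
      using root by (intro card_mono poly_roots_finite nz) auto
    also have "\<dots> \<le> degree (Q - monom 1 j)"
      by (rule card_poly_roots_bound[OF nz])
    also have "\<dots> \<le> i"
      using \<open>degree Q \<le> i\<close> \<open>j \<le> i\<close> by (intro degree_diff_le) (simp_all add: degree_monom_eq)
    finally show False by simp
  qed
  then have "coeff Q i = coeff (monom 1 j) i"
    by simp
  moreover have "coeff Q i = (\<Sum>l\<le>i. y l ^ j / w l)"
    unfolding Q_def coeff_sum coeff_smult
    by (intro sum.cong) (use leadP degP in auto)
  ultimately show ?thesis
    by (simp add: w_def)
qed

text \<open>
  A Leja sequence read backwards: the last point maximises \<open>\<phi>\<close>, and each earlier one maximises \<open>\<phi>\<close> times the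
  product of the distances to the points already chosen after it. The weight \<open>\<phi>\<close> is what makes the
  induction work; only \<open>\<phi> = 1\<close> is of interest in the end.
\<close>
lemma reverse_Leja_order:
  fixes X :: "complex set" and \<phi> :: "complex \<Rightarrow> real"
  assumes "finite X" and "card X = n"
  shows "\<exists>z. bij_betw z {..<n} X \<and>
    (\<forall>i<n. \<forall>l\<le>i. \<phi> (z l) * (\<Prod>s\<in>{i<..<n}. cmod (z l - z s))
                 \<le> \<phi> (z i) * (\<Prod>s\<in>{i<..<n}. cmod (z i - z s)))"
  using assms
proof (induction n arbitrary: X \<phi>)
  case 0
  then show ?case by (auto simp: bij_betw_def)
next
  case (Suc n)
  then have "X \<noteq> {}" by auto
  have "Max (\<phi> ` X) \<in> \<phi> ` X"
    using \<open>X \<noteq> {}\<close> \<open>finite X\<close> by (intro Max_in) auto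
  then obtain a where "a \<in> X" "\<phi> a = Max (\<phi> ` X)"
    by force
  then have a: "a \<in> X" "\<And>x. x \<in> X \<Longrightarrow> \<phi> x \<le> \<phi> a"
    using \<open>finite X\<close> by auto
  have "card (X - {a}) = n" "finite (X - {a})"
    using a Suc.prems by auto
  from Suc.IH[OF this(2,1), of "\<lambda>v. \<phi> v * cmod (v - a)"] obtain z where
    bij: "bij_betw z {..<n} (X - {a})" and
    z: "\<And>i l. i < n \<Longrightarrow> l \<le> i \<Longrightarrow>
      \<phi> (z l) * cmod (z l - a) * (\<Prod>s\<in>{i<..<n}. cmod (z l - z s))
      \<le> \<phi> (z i) * cmod (z i - a) * (\<Prod>s\<in>{i<..<n}. cmod (z i - z s))"
    by blast
  define z' where "z' = z(n := a)"
  have "bij_betw z' {..<n} (X - {a})"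
    using bij by (subst bij_betw_cong[of _ _ z]) (auto simp: z'_def)
  then have "bij_betw z' ({..<n} \<union> {n}) (X - {a} \<union> {a})"
    by (intro bij_betw_combine) (auto simp: z'_def bij_betw_def)
  then have bij': "bij_betw z' {..<Suc n} X"
    using a by (simp add: lessThan_Suc insert_absorb)
  have "\<phi> (z' l) * (\<Prod>s\<in>{i<..<Suc n}. cmod (z' l - z' s))
      \<le> \<phi> (z' i) * (\<Prod>s\<in>{i<..<Suc n}. cmod (z' i - z' s))" if "i < Suc n" "l \<le> i" for i l
  proof (cases "i = n")
    case True
    have "z' l \<in> X"
      using bij' that by (auto simp: bij_betw_def)
    then show ?thesis
      using True a by (simp add: z'_def)
  next
    case False
    then have "i < n" using that by simp
    have prod_eq: "(\<Prod>s\<in>{i<..<Suc n}. cmod (v - z' s)) = cmod (v - a) * (\<Prod>s\<in>{i<..<n}. cmod (v - z s))" for v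
    proof -
      have "{i<..<Suc n} = insert n {i<..<n}"
        using \<open>i < n\<close> by auto
      then show ?thesis
        by (simp add: z'_def)
    qed
    show ?thesis
      using z[OF \<open>i < n\<close> \<open>l \<le> i\<close>] \<open>i < n\<close> \<open>l \<le> i\<close>
      unfolding prod_eq by (simp add: z'_def mult_ac)
  qed
  with bij' show ?case by blast
qed

text \<open>
  The contribution of the coefficients of index above \<open>i\<close> to the divided difference at
  \<open>y\<^sub>0, \<dots>, y\<^sub>i\<close>.
\<close>
definition divdiff_tail :: "real \<Rightarrow> (nat \<Rightarrow> complex) \<Rightarrow> nat \<Rightarrow> (nat \<Rightarrow> complex) \<Rightarrow> complex" where
  "divdiff_tail L y i a = (\<Sum>j. a (j + Suc i) * of_real (gef_weight L (j + Suc i)) *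
     (\<Sum>l\<le>i. y l ^ (j + Suc i) / (\<Prod>s\<in>{..i}-{l}. y l - y s)))"

lemma divided_difference_GEF:
  assumes a: "tempered t a" "t \<ge> 0" "L > 0" and inj: "inj_on y {..i}"
  shows "(\<Sum>l\<le>i. GEF L a (y l) / (\<Prod>s\<in>{..i}-{l}. y l - y s))
       = of_real (gef_weight L i) * a i + divdiff_tail L y i a"
proof -
  let ?W = "\<lambda>l. \<Prod>s\<in>{..i}-{l}. y l - y s"
  let ?c = "\<lambda>n. \<Sum>l\<le>i. y l ^ n / ?W l"
  let ?f = "\<lambda>n. a n * of_real (gef_weight L n) * ?c n"
  have "(\<lambda>n. \<Sum>l\<le>i. a n * of_real (gef_weight L n) * y l ^ n / ?W l) sums (\<Sum>l\<le>i. GEF L a (y l) / ?W l)"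
    unfolding GEF_eq_weighted[OF \<open>L > 0\<close>]
    by (intro sums_sum sums_divide summable_sums summable_norm_cancel[OF tempered_summable[OF a]])
  moreover have "(\<Sum>l\<le>i. a n * of_real (gef_weight L n) * y l ^ n / ?W l) = ?f n" for n
    by (simp add: sum_distrib_left)
  ultimately have S: "?f sums (\<Sum>l\<le>i. GEF L a (y l) / ?W l)" by simp
  have "?c n = (if n = i then 1 else 0)" if "n \<le> i" for n
    by (rule divided_difference_power[OF inj that])
  then have "(\<Sum>n<Suc i. ?f n) = (\<Sum>n<Suc i. if n = i then a i * of_real (gef_weight L i) else 0)"
    by (intro sum.cong) auto
  also have "\<dots> = a i * of_real (gef_weight L i)"
    by simp
  finally have head: "(\<Sum>n<Suc i. ?f n) = a i * of_real (gef_weight L i)" .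
  have "(\<Sum>n. ?f n) = (\<Sum>n. ?f (n + Suc i)) + (\<Sum>n<Suc i. ?f n)"
    by (rule suminf_split_initial_segment[OF sums_summable[OF S]])
  then show ?thesis
    using S unfolding head divdiff_tail_def sums_iff by (simp add: mult.commute add.commute)
qed

lemma prod_le_two_power_prod:
  fixes f g :: "nat \<Rightarrow> real"
  assumes "finite A" "card A \<le> n" "\<And>s. s \<in> A \<Longrightarrow> 0 \<le> f s \<and> f s \<le> 2 * g s"
  shows "prod f A \<le> 2 ^ n * prod g A"
proof -
  have g: "0 \<le> g s" if "s \<in> A" for s
    using assms(3)[OF that] by linarith
  have "prod f A \<le> (\<Prod>s\<in>A. 2 * g s)"
    by (rule prod_mono) (use assms in auto)
  also have "\<dots> = 2 ^ card A * prod g A"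
    by (simp add: prod.distrib)
  also have "\<dots> \<le> 2 ^ n * prod g A"
    using assms(2) g by (intro mult_right_mono power_increasing prod_nonneg) auto
  finally show ?thesis .
qed

text \<open>
  The value \<open>f (y l)\<close> contains all distances from \<open>y l\<close>, and the denominator removes those to the
  points of index at most \<open>i\<close>. What remains is the product of the distances from \<open>y l\<close> to the points of
  larger index, which the Leja order bounds by the one for \<open>l = i\<close>. Without that order
  the bound would not multiply up to the Vandermonde product. Each exchange of
  exact for approximate zeros costs a factor \<open>2\<^sup>n\<close>, and there are three of them.
\<close>
lemma divided_difference_near_zeros:
  fixes y z :: "nat \<Rightarrow> complex" and f :: "complex \<Rightarrow> complex"
  assumes f: "\<And>l. l < n \<Longrightarrow> cmod (f (y l)) \<le> B * (\<Prod>j<n. cmod (y l - z j))" and "B \<ge> 0"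
    and near: "\<And>l. l < n \<Longrightarrow> cmod (y l - z l) \<le> \<eta>"
    and sep: "\<And>l j. l < n \<Longrightarrow> j < n \<Longrightarrow> l \<noteq> j \<Longrightarrow> y l \<noteq> y j \<and>
        cmod (y l - z j) \<le> 2 * cmod (y l - y j) \<and>
        cmod (y l - y j) \<le> 2 * cmod (z l - z j) \<and> cmod (z l - z j) \<le> 2 * cmod (y l - y j)"
    and Leja: "\<And>l. l \<le> i \<Longrightarrow> (\<Prod>s\<in>{i<..<n}. cmod (z l - z s)) \<le> (\<Prod>s\<in>{i<..<n}. cmod (z i - z s))"
    and "i < n"
  shows "cmod (\<Sum>l\<le>i. f (y l) / (\<Prod>s\<in>{..i}-{l}. y l - y s))
       \<le> real n * (B * \<eta> * 8 ^ n * (\<Prod>s\<in>{i<..<n}. cmod (y i - y s)))"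
proof -
  have each: "cmod (f (y l) / (\<Prod>s\<in>{..i}-{l}. y l - y s))
      \<le> B * \<eta> * 8 ^ n * (\<Prod>s\<in>{i<..<n}. cmod (y i - y s))" if "l \<le> i" for l
  proof -
    let ?A = "{..i}-{l}" and ?C = "{i<..<n}"
    let ?PA = "\<Prod>s\<in>?A. cmod (y l - y s)"
    have l: "l < n" using that \<open>i < n\<close> by simp
    have \<eta>: "\<eta> \<ge> 0" using near[OF l] norm_ge_zero order_trans by blast
    have split: "{..<n} - {l} = ?A \<union> ?C" "?A \<inter> ?C = {}"
      using that \<open>i < n\<close> by auto
    have PA: "?PA > 0"
    proof (intro prod_pos)
      fix s assume "s \<in> ?A"
      then have "y l \<noteq> y s" using sep[OF l, of s] \<open>i < n\<close> by auto
      then show "cmod (y l - y s) > 0" by simp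
    qed
    have card_le: "card ?C \<le> n" by simp
    have "(\<Prod>j<n. cmod (y l - z j)) = cmod (y l - z l) * (\<Prod>j\<in>{..<n}-{l}. cmod (y l - z j))"
      using l by (subst prod.remove[of _ l]) auto
    also have "\<dots> \<le> \<eta> * (2 ^ n * (\<Prod>j\<in>{..<n}-{l}. cmod (y l - y j)))"
      using sep l near[OF l] \<eta>
      by (intro mult_mono prod_le_two_power_prod prod_nonneg) (auto simp: card_Diff_subset)
    also have "(\<Prod>j\<in>{..<n}-{l}. cmod (y l - y j)) = ?PA * (\<Prod>s\<in>?C. cmod (y l - y s))"
      unfolding split(1) by (rule prod.union_disjoint) (use split(2) in auto)
    finally have 1: "(\<Prod>j<n. cmod (y l - z j)) \<le> \<eta> * (2 ^ n * (?PA * (\<Prod>s\<in>?C. cmod (y l - y s))))" .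
    have "(\<Prod>s\<in>?C. cmod (y l - y s)) \<le> 2 ^ n * (\<Prod>s\<in>?C. cmod (z l - z s))"
      using sep l that by (intro prod_le_two_power_prod) auto
    also have "\<dots> \<le> 2 ^ n * (\<Prod>s\<in>?C. cmod (z i - z s))"
      by (intro mult_left_mono Leja that) auto
    also have "\<dots> \<le> 2 ^ n * (2 ^ n * (\<Prod>s\<in>?C. cmod (y i - y s)))"
      using sep \<open>i < n\<close> by (intro mult_left_mono prod_le_two_power_prod) auto
    finally have 2: "(\<Prod>s\<in>?C. cmod (y l - y s)) \<le> 2 ^ n * (2 ^ n * (\<Prod>s\<in>?C. cmod (y i - y s)))" .
    have "cmod (f (y l)) \<le> B * (\<eta> * (2 ^ n * (?PA * (2 ^ n * (2 ^ n * (\<Prod>s\<in>?C. cmod (y i - y s)))))))"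
    proof -
      have "\<eta> * (2 ^ n * (?PA * (\<Prod>s\<in>?C. cmod (y l - y s))))
          \<le> \<eta> * (2 ^ n * (?PA * (2 ^ n * (2 ^ n * (\<Prod>s\<in>?C. cmod (y i - y s))))))"
        using 2 \<eta> PA by (intro mult_left_mono) auto
      with 1 have "(\<Prod>j<n. cmod (y l - z j)) \<le> \<eta> * (2 ^ n * (?PA * (2 ^ n * (2 ^ n * (\<Prod>s\<in>?C. cmod (y i - y s))))))"
        by (rule order_trans)
      then show ?thesis
        using f[OF l] \<open>B \<ge> 0\<close> mult_left_mono order_trans by blast
    qed
    also have "\<dots> = B * \<eta> * 8 ^ n * (\<Prod>s\<in>?C. cmod (y i - y s)) * ?PA"
      by (simp add: power_mult_distrib[symmetric] mult_ac)
    finally show ?thesis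
      using PA by (simp add: norm_divide prod_norm[symmetric] field_simps)
  qed
  have "cmod (\<Sum>l\<le>i. f (y l) / (\<Prod>s\<in>{..i}-{l}. y l - y s))
      \<le> (\<Sum>l\<le>i. B * \<eta> * 8 ^ n * (\<Prod>s\<in>{i<..<n}. cmod (y i - y s)))"
    by (rule order_trans[OF norm_sum sum_mono]) (use each in auto)
  also have "\<dots> = real (Suc i) * (B * \<eta> * 8 ^ n * (\<Prod>s\<in>{i<..<n}. cmod (y i - y s)))"
    by simp
  also have "\<dots> \<le> real n * (B * \<eta> * 8 ^ n * (\<Prod>s\<in>{i<..<n}. cmod (y i - y s)))"
  proof (rule mult_right_mono)
    have "\<eta> \<ge> 0" using near[OF \<open>i < n\<close>] norm_ge_zero order_trans by blast
    then show "0 \<le> B * \<eta> * 8 ^ n * (\<Prod>s\<in>{i<..<n}. cmod (y i - y s))"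
      using \<open>B \<ge> 0\<close> by (intro mult_nonneg_nonneg prod_nonneg) auto
  qed (use \<open>i < n\<close> in simp)
  finally show ?thesis .
qed

section \<open>Nets of approximate zeros\<close>

definition grid :: "real \<Rightarrow> nat \<Rightarrow> complex set" where
  "grid R q = (\<lambda>(a, b). Complex (of_int a / real (Suc q)) (of_int b / real (Suc q))) `
     ({- \<lceil>R * real (Suc q)\<rceil>..\<lceil>R * real (Suc q)\<rceil>} \<times> {- \<lceil>R * real (Suc q)\<rceil>..\<lceil>R * real (Suc q)\<rceil>})"

lemma finite_grid [simp]: "finite (grid R q)"
  by (simp add: grid_def)

lemma card_grid_le:
  assumes "R \<ge> 3"
  shows "real (card (grid R q)) \<le> 9 * R\<^sup>2 * (real (Suc q))\<^sup>2"
proof -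
  define K where "K = \<lceil>R * real (Suc q)\<rceil>"
  have "3 * 1 \<le> R * real (Suc q)"
    using assms by (intro mult_mono) auto
  then have u: "3 \<le> R * real (Suc q)" by simp
  then have "0 \<le> K" "real_of_int K \<le> R * real (Suc q) + 1"
    unfolding K_def by linarith+
  then have K: "2 * real_of_int K + 1 \<le> 3 * (R * real (Suc q))" using u by linarith
  have "card (grid R q) \<le> card ({- K..K} \<times> {- K..K})"
    unfolding grid_def K_def[symmetric] by (rule card_image_le) simp
  also have "\<dots> = nat (2 * K + 1) * nat (2 * K + 1)"
    by (simp add: card_cartesian_product algebra_simps)
  finally have "real (card (grid R q)) \<le> real (nat (2 * K + 1) * nat (2 * K + 1))"
    by (simp only: of_nat_le_iff)
  also have "\<dots> = (2 * real_of_int K + 1) * (2 * real_of_int K + 1)"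
    using \<open>0 \<le> K\<close> by simp
  also have "\<dots> \<le> (3 * (R * real (Suc q))) * (3 * (R * real (Suc q)))"
    using K \<open>0 \<le> K\<close> u by (intro mult_mono) auto
  also have "\<dots> = 9 * R\<^sup>2 * (real (Suc q))\<^sup>2"
    by (simp add: power2_eq_square algebra_simps)
  finally show ?thesis .
qed

lemma grid_approx:
  assumes "cmod z \<le> R"
  shows "\<exists>y\<in>grid R q. cmod (y - z) \<le> 2 / real (Suc q)"
proof -
  let ?s = "real (Suc q)"
  have s: "?s > 0" by simp
  have coord: "\<lfloor>x * ?s\<rfloor> \<in> {- \<lceil>R * ?s\<rceil>..\<lceil>R * ?s\<rceil>} \<and> \<bar>of_int \<lfloor>x * ?s\<rfloor> / ?s - x\<bar> \<le> 1 / ?s"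
    if "\<bar>x\<bar> \<le> R" for x
  proof -
    have "x * ?s \<le> R * ?s" "(- R) * ?s \<le> x * ?s"
      using that by (intro mult_right_mono; simp)+
    then have "\<lfloor>x * ?s\<rfloor> \<in> {- \<lceil>R * ?s\<rceil>..\<lceil>R * ?s\<rceil>}"
      unfolding atLeastAtMost_iff by linarith
    moreover have "\<bar>of_int \<lfloor>x * ?s\<rfloor> - x * ?s\<bar> \<le> 1" by linarith
    then have "\<bar>of_int \<lfloor>x * ?s\<rfloor> - x * ?s\<bar> / ?s \<le> 1 / ?s"
      using s by (intro divide_right_mono) auto
    moreover have "of_int \<lfloor>x * ?s\<rfloor> / ?s - x = (of_int \<lfloor>x * ?s\<rfloor> - x * ?s) / ?s"
      using s by (simp only: diff_divide_distrib nonzero_mult_div_cancel_right less_imp_neq[OF s, symmetric] not_False_eq_True)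
    then have "\<bar>of_int \<lfloor>x * ?s\<rfloor> / ?s - x\<bar> = \<bar>of_int \<lfloor>x * ?s\<rfloor> - x * ?s\<bar> / ?s"
      by (simp only: abs_divide abs_of_nat)
    ultimately show ?thesis by (simp only: simp_thms)
  qed
  define y where "y = Complex (of_int \<lfloor>Re z * ?s\<rfloor> / ?s) (of_int \<lfloor>Im z * ?s\<rfloor> / ?s)"
  have re: "\<bar>Re z\<bar> \<le> R" and im: "\<bar>Im z\<bar> \<le> R"
    using abs_Re_le_cmod[of z] abs_Im_le_cmod[of z] assms by linarith+
  have "y \<in> grid R q"
    unfolding grid_def y_def using coord[OF re] coord[OF im]
    by (intro image_eqI[of _ _ "(\<lfloor>Re z * ?s\<rfloor>, \<lfloor>Im z * ?s\<rfloor>)"]) auto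
  moreover have "cmod (y - z) \<le> \<bar>Re (y - z)\<bar> + \<bar>Im (y - z)\<bar>"
    by (rule cmod_le)
  moreover have "\<bar>Re (y - z)\<bar> \<le> 1 / ?s" "\<bar>Im (y - z)\<bar> \<le> 1 / ?s"
    using coord[OF re] coord[OF im] by (simp_all add: y_def)
  ultimately show ?thesis by (intro bexI[of _ y]) auto
qed

text \<open>
  Tuples are extensional functions so that there are finitely many. The constraint retains from the
  product separations of the zeros the only information that is used, a bound on the Vandermonde
  product.
\<close>
definition separated_configs :: "real \<Rightarrow> real \<Rightarrow> nat \<Rightarrow> nat \<Rightarrow> (nat \<Rightarrow> complex) set" where
  "separated_configs R V n q =
     {y \<in> {..<n} \<rightarrow>\<^sub>E grid R q. (\<Prod>i<n. (\<Prod>s\<in>{i<..<n}. cmod (y i - y s))\<^sup>2) \<le> V}"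

definition divdiff_tolerance :: "real \<Rightarrow> nat \<Rightarrow> nat \<Rightarrow> (nat \<Rightarrow> complex) \<Rightarrow> nat \<Rightarrow> real" where
  "divdiff_tolerance B n q y i =
     real n * (B * (2 / real (Suc q)) * 8 ^ n * (\<Prod>s\<in>{i<..<n}. cmod (y i - y s)))"

text \<open>
  As the mesh tends to \<open>0\<close>, nearest net points converge to the zeros. Since these are distinct, all
  ratios of corresponding distances tend to \<open>1\<close>.
\<close>
lemma eventually_near_config:
  assumes a: "tempered m a" "L > 0" "R \<ge> 1" "m = L * R\<^sup>2"
    and X: "finite X" "X \<subseteq> cball 0 R \<inter> GEF_zeros L a"
    and n: "n = card X"
    and V: "(\<Prod>z\<in>X. \<Prod>w\<in>X-{z}. cmod (z - w)) < V"
  shows "\<forall>\<^sub>F q in sequentially. \<exists>y\<in>separated_configs R V n q. \<forall>i<n.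
     cmod (of_real (gef_weight L i) * a i + divdiff_tail L y i a)
       \<le> divdiff_tolerance (6 * exp (197 * m) / (6 * R) ^ n) n q y i"
proof -
  let ?B = "6 * exp (197 * m) / (6 * R) ^ n"
  have m: "m > 0" using assms by simp
  obtain z where bij: "bij_betw z {..<n} X" and
    Leja: "\<And>i l. i < n \<Longrightarrow> l \<le> i \<Longrightarrow>
      (\<Prod>s\<in>{i<..<n}. cmod (z l - z s)) \<le> (\<Prod>s\<in>{i<..<n}. cmod (z i - z s))"
    using reverse_Leja_order[OF X(1) n[symmetric], of "\<lambda>_. 1"] by auto
  have zX: "z i \<in> X" if "i < n" for i
    using bij that by (auto simp: bij_betw_def)
  then have zR: "cmod (z i) \<le> R" if "i < n" for i
    using X(2) that by force
  have zne: "z i \<noteq> z j" if "i < n" "j < n" "i \<noteq> j" for i j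
    using bij that by (auto simp: bij_betw_def inj_on_def)
  define y0 where "y0 q i = (SOME y. y \<in> grid R q \<and> cmod (y - z i) \<le> 2 / real (Suc q))" for q i
  have y0: "y0 q i \<in> grid R q \<and> cmod (y0 q i - z i) \<le> 2 / real (Suc q)" if "i < n" for q i
    unfolding y0_def by (rule someI_ex) (use grid_approx[OF zR[OF that]] in blast)
  define y where "y q = restrict (y0 q) {..<n}" for q
  have yE: "y q \<in> {..<n} \<rightarrow>\<^sub>E grid R q" for q
    using y0 by (auto simp: y_def)
  have near: "cmod (y q i - z i) \<le> 2 / real (Suc q)" if "i < n" for q i
    using y0 that by (simp add: y_def)
  have null: "(\<lambda>q. 2 / real (Suc q)) \<longlonglongrightarrow> 0"
    by real_asymp
  have "(\<lambda>q. y q i - z i) \<longlonglongrightarrow> 0" if "i < n" for i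
    by (rule Lim_null_comparison[OF _ null]) (use near[OF that] in auto)
  then have lim: "(\<lambda>q. y q i) \<longlonglongrightarrow> z i" if "i < n" for i
    using that LIM_zero_iff by blast
  have "\<forall>\<^sub>F q in sequentially. \<forall>l\<in>{..<n}. \<forall>j\<in>{..<n}. l \<noteq> j \<longrightarrow> y q l \<noteq> y q j \<and>
        cmod (y q l - z j) \<le> 2 * cmod (y q l - y q j) \<and>
        cmod (y q l - y q j) \<le> 2 * cmod (z l - z j) \<and> cmod (z l - z j) \<le> 2 * cmod (y q l - y q j)"
  proof (intro eventually_ball_finite finite_lessThan ballI)
    fix l j assume lj: "l \<in> {..<n}" "j \<in> {..<n}"
    show "\<forall>\<^sub>F q in sequentially. l \<noteq> j \<longrightarrow> y q l \<noteq> y q j \<and>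
        cmod (y q l - z j) \<le> 2 * cmod (y q l - y q j) \<and>
        cmod (y q l - y q j) \<le> 2 * cmod (z l - z j) \<and> cmod (z l - z j) \<le> 2 * cmod (y q l - y q j)"
    proof (cases "l = j")
      case False
      let ?d = "cmod (z l - z j)"
      have d: "?d > 0" using zne lj False by auto
      have 1: "(\<lambda>q. cmod (y q l - z j)) \<longlonglongrightarrow> ?d" and 2: "(\<lambda>q. cmod (y q l - y q j)) \<longlonglongrightarrow> ?d"
        using lj by (auto intro!: tendsto_norm tendsto_diff lim)
      have "\<forall>\<^sub>F q in sequentially. cmod (y q l - z j) < 3 / 2 * ?d"
        by (rule order_tendstoD(2)[OF 1]) (use d in simp)
      moreover have "\<forall>\<^sub>F q in sequentially. cmod (y q l - y q j) < 2 * ?d"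
        by (rule order_tendstoD(2)[OF 2]) (use d in simp)
      moreover have "\<forall>\<^sub>F q in sequentially. 3 / 4 * ?d < cmod (y q l - y q j)"
        by (rule order_tendstoD(1)[OF 2]) (use d in simp)
      ultimately show ?thesis
      proof eventually_elim
        case (elim q)
        have "y q l \<noteq> y q j"
        proof
          assume "y q l = y q j"
          with elim(3) d show False by simp
        qed
        with elim d show ?case by linarith
      qed
    qed simp
  qed
  moreover have "\<forall>\<^sub>F q in sequentially. (\<Prod>i<n. (\<Prod>s\<in>{i<..<n}. cmod (y q i - y q s))\<^sup>2) < V"
  proof (rule order_tendstoD(2))
    show "(\<lambda>q. \<Prod>i<n. (\<Prod>s\<in>{i<..<n}. cmod (y q i - y q s))\<^sup>2)
        \<longlonglongrightarrow> (\<Prod>i<n. (\<Prod>s\<in>{i<..<n}. cmod (z i - z s))\<^sup>2)"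
      by (intro tendsto_prod tendsto_power tendsto_norm tendsto_diff lim) auto
    have "(\<Prod>i<n. (\<Prod>s\<in>{i<..<n}. cmod (z i - z s))\<^sup>2) = (\<Prod>i<n. \<Prod>s\<in>{..<n}-{i}. cmod (z i - z s))"
      by (rule prod_ordered_pairs) (rule norm_minus_commute)
    also have "\<dots> = (\<Prod>i<n. \<Prod>w\<in>X-{z i}. cmod (z i - w))"
    proof (rule prod.cong[OF refl])
      fix i assume "i \<in> {..<n}"
      have "bij_betw z ({..<n} - {i}) (X - {z i})"
        using bij \<open>i \<in> {..<n}\<close> by (auto simp: bij_betw_def inj_on_def)
      then show "(\<Prod>s\<in>{..<n}-{i}. cmod (z i - z s)) = (\<Prod>w\<in>X-{z i}. cmod (z i - w))"
        by (rule prod.reindex_bij_betw)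
    qed
    also have "\<dots> = (\<Prod>z\<in>X. \<Prod>w\<in>X-{z}. cmod (z - w))"
      using bij by (rule prod.reindex_bij_betw)
    finally show "(\<Prod>i<n. (\<Prod>s\<in>{i<..<n}. cmod (z i - z s))\<^sup>2) < V" using V by simp
  qed
  ultimately show ?thesis
  proof eventually_elim
    case (elim q)
    have "cmod (of_real (gef_weight L i) * a i + divdiff_tail L (y q) i a)
       \<le> divdiff_tolerance ?B n q (y q) i" if "i < n" for i
    proof -
      have "inj_on (y q) {..i}"
        using elim(1) that by (force simp: inj_on_def)
      then have "of_real (gef_weight L i) * a i + divdiff_tail L (y q) i a
          = (\<Sum>l\<le>i. GEF L a (y q l) / (\<Prod>s\<in>{..i}-{l}. y q l - y q s))"
        using divided_difference_GEF[OF a(1) less_imp_le[OF m] a(2)] by simp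
      moreover have "cmod (\<Sum>l\<le>i. GEF L a (y q l) / (\<Prod>s\<in>{..i}-{l}. y q l - y q s))
          \<le> divdiff_tolerance ?B n q (y q) i"
        unfolding divdiff_tolerance_def
      proof (rule divided_difference_near_zeros)
        fix l assume l: "l < n"
        have "2 / real (Suc q) \<le> 2" by (simp add: field_simps)
        then have "cmod (y q l) \<le> 7 * R"
          using near[OF l, of q] zR[OF l] norm_triangle_sub[of "y q l" "z l"] \<open>R \<ge> 1\<close> by linarith
        then have "cmod (GEF L a (y q l)) \<le> ?B * (\<Prod>w\<in>X. cmod (y q l - w))"
          unfolding n using a X by (intro GEF_le_prod_zeros) auto
        also have "(\<Prod>w\<in>X. cmod (y q l - w)) = (\<Prod>j<n. cmod (y q l - z j))"
          using prod.reindex_bij_betw[OF bij, of "\<lambda>w. cmod (y q l - w)"] by simp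
        finally show "cmod (GEF L a (y q l)) \<le> ?B * (\<Prod>j<n. cmod (y q l - z j))" .
      qed (use elim(1) near Leja that \<open>R \<ge> 1\<close> in auto)
      ultimately show ?thesis by simp
    qed
    moreover have "y q \<in> separated_configs R V n q"
      using yE elim(2) by (simp add: separated_configs_def)
    ultimately show ?case by blast
  qed
qed

lemma divdiff_tail_restrict: "divdiff_tail L y i (restrict a {Suc i..}) = divdiff_tail L y i a"
  by (simp add: divdiff_tail_def)

lemma measurable_divdiff_tail:
  "divdiff_tail L y i \<in> borel_measurable (PiM {Suc i..} (\<lambda>_. borel))"
proof -
  have [measurable]: "(\<lambda>a. a (j + Suc i)) \<in> borel_measurable (PiM {Suc i..} (\<lambda>_. borel :: complex measure))" for j
    by (rule measurable_component_singleton) simp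
  show ?thesis
    unfolding divdiff_tail_def[abs_def] by measurable
qed

lemma finite_separated_configs [simp]: "finite (separated_configs R V n q)"
  unfolding separated_configs_def by (intro finite_Collect_conjI disjI1) (simp add: finite_PiE)

text \<open>
  Fatou's lemma for events.
\<close>
lemma (in prob_space) prob_liminf_le:
  fixes A :: "nat \<Rightarrow> 'a set"
  assumes A: "\<And>q. A q \<in> events" and b: "\<And>q. prob (A q) \<le> b"
  shows "prob (\<Union>p. \<Inter>q\<in>{p..}. A q) \<le> b" "(\<Union>p. \<Inter>q\<in>{p..}. A q) \<in> events"
proof -
  let ?C = "\<lambda>p::nat. \<Inter>q\<in>{p..}. A q"
  have C: "?C p \<in> events" for p
    by (rule sets.countable_INT') (use A in auto)
  have "(\<lambda>p. prob (?C p)) \<longlonglongrightarrow> prob (\<Union>p. ?C p)"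
    by (rule finite_Lim_measure_incseq) (use C in \<open>auto simp: incseq_def\<close>)
  moreover have "prob (?C p) \<le> b" for p
  proof -
    have "prob (?C p) \<le> prob (A p)" by (rule finite_measure_mono) (use A in auto)
    then show ?thesis using b[of p] by simp
  qed
  ultimately show "prob (\<Union>p. ?C p) \<le> b"
    by (intro LIMSEQ_le_const2) auto
  show "(\<Union>p. ?C p) \<in> events" using C by blast
qed

text \<open>
  The bound of \<open>prob_net_event_le\<close> for \<open>n\<close> zeros, with the Vandermonde bound of
  \<open>prod_dist_close_points_le\<close>, doubled to make the inequality strict at the zeros and hence stable
  under approximation.
\<close>
definition config_bound :: "real \<Rightarrow> real \<Rightarrow> real \<Rightarrow> nat \<Rightarrow> nat \<Rightarrow> real" where
  "config_bound L R \<sigma> k n = (9 * R\<^sup>2 * (2 * real n * (6 * exp (197 * (L * R\<^sup>2)) / (6 * R) ^ n) * 8 ^ n)\<^sup>2) ^ n *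
     (2 * \<sigma> ^ k * (2 * R) ^ n\<^sup>2) / (\<Prod>i<n. (gef_weight L i)\<^sup>2)"

context iid_complex_normal
begin

definition net_event :: "real \<Rightarrow> real \<Rightarrow> real \<Rightarrow> real \<Rightarrow> nat \<Rightarrow> nat \<Rightarrow> 'a set" where
  "net_event L R B V n q = (\<Union>y\<in>separated_configs R V n q. {\<omega>\<in>space M. \<forall>i\<in>{0..<n}.
     cmod (of_real (gef_weight L i) * \<zeta> i \<omega> + divdiff_tail L y i (restrict (\<lambda>j. \<zeta> j \<omega>) {Suc i..}))
       \<le> divdiff_tolerance B n q y i})"

lemma sets_divdiff_small:
  "{\<omega>\<in>space M. \<forall>i\<in>{0..<n}.
     cmod (of_real (gef_weight L i) * \<zeta> i \<omega> + divdiff_tail L y i (restrict (\<lambda>j. \<zeta> j \<omega>) {Suc i..}))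
       \<le> divdiff_tolerance B n q y i} \<in> sets M"
proof -
  have [measurable]: "(\<lambda>\<omega>. divdiff_tail L y i (restrict (\<lambda>j. \<zeta> j \<omega>) {Suc i..})) \<in> borel_measurable M" for i
    by (rule measurable_compose[OF measurable_restrict measurable_divdiff_tail]) (rule measurable_coeff)
  show ?thesis by measurable
qed

lemma sets_net_event [measurable]: "net_event L R B V n q \<in> sets M"
  unfolding net_event_def by (intro sets.finite_UN finite_separated_configs sets_divdiff_small)

text \<open>
  The mesh has cancelled: \<open>(Suc q)\<^sup>2\<^sup>n\<close> from the number of configurations against \<open>(Suc q)\<^sup>-\<^sup>2\<^sup>n\<close> from the
  tolerances.
\<close>
lemma prob_net_event_le:
  assumes "L > 0" "R \<ge> 3" "B \<ge> 0" "V \<ge> 0"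
  shows "prob (net_event L R B V n q)
    \<le> (9 * R\<^sup>2 * (2 * real n * B * 8 ^ n)\<^sup>2) ^ n * V / (\<Prod>i<n. (gef_weight L i)\<^sup>2)"
proof -
  let ?S = "separated_configs R V n q" and ?s = "real (Suc q)"
  let ?W = "\<Prod>i<n. (gef_weight L i)\<^sup>2"
  let ?c = "real n * (B * (2 / ?s) * 8 ^ n)"
  have W: "?W > 0"
    by (intro prod_pos zero_less_power gef_weight_pos \<open>L > 0\<close>)
  have each: "prob {\<omega>\<in>space M. \<forall>i\<in>{0..<n}.
     cmod (of_real (gef_weight L i) * \<zeta> i \<omega> + divdiff_tail L y i (restrict (\<lambda>j. \<zeta> j \<omega>) {Suc i..}))
       \<le> divdiff_tolerance B n q y i} \<le> (?c\<^sup>2) ^ n * V / ?W" if y: "y \<in> ?S" for y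
  proof -
    have "prob {\<omega>\<in>space M. \<forall>i\<in>{0..<n}.
     cmod (of_real (gef_weight L i) * \<zeta> i \<omega> + divdiff_tail L y i (restrict (\<lambda>j. \<zeta> j \<omega>) {Suc i..}))
       \<le> divdiff_tolerance B n q y i} \<le> (\<Prod>i\<in>{0..<n}. (divdiff_tolerance B n q y i / gef_weight L i)\<^sup>2)"
    proof (rule prob_triangular_le)
      show "divdiff_tolerance B n q y i \<ge> 0" for i
        unfolding divdiff_tolerance_def using \<open>B \<ge> 0\<close>
        by (intro mult_nonneg_nonneg prod_nonneg) auto
    qed (use measurable_divdiff_tail gef_weight_pos[OF \<open>L > 0\<close>] in auto)
    also have "\<dots> = (\<Prod>i<n. ?c\<^sup>2 * (\<Prod>s\<in>{i<..<n}. cmod (y i - y s))\<^sup>2 / (gef_weight L i)\<^sup>2)"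
      by (rule prod.cong) (auto simp: divdiff_tolerance_def power_mult_distrib power_divide)
    also have "\<dots> = (?c\<^sup>2) ^ n * (\<Prod>i<n. (\<Prod>s\<in>{i<..<n}. cmod (y i - y s))\<^sup>2) / ?W"
      by (simp only: prod_dividef prod.distrib prod_constant card_lessThan)
    also have "\<dots> \<le> (?c\<^sup>2) ^ n * V / ?W"
      using y W by (intro divide_right_mono mult_left_mono) (auto simp: separated_configs_def)
    finally show ?thesis .
  qed
  have cardS: "real (card ?S) \<le> (9 * R\<^sup>2 * ?s\<^sup>2) ^ n"
  proof -
    have "card ?S \<le> card ({..<n} \<rightarrow>\<^sub>E grid R q)"
      by (rule card_mono) (auto simp: separated_configs_def intro: finite_PiE)
    then have "real (card ?S) \<le> real (card (grid R q)) ^ n"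
      by (simp only: card_PiE[OF finite_lessThan] prod_constant card_lessThan of_nat_power[symmetric] of_nat_le_iff)
    also have "\<dots> \<le> (9 * R\<^sup>2 * ?s\<^sup>2) ^ n"
      by (intro power_mono card_grid_le assms) simp
    finally show ?thesis .
  qed
  have "prob (net_event L R B V n q) \<le> (\<Sum>y\<in>?S. prob {\<omega>\<in>space M. \<forall>i\<in>{0..<n}.
     cmod (of_real (gef_weight L i) * \<zeta> i \<omega> + divdiff_tail L y i (restrict (\<lambda>j. \<zeta> j \<omega>) {Suc i..}))
       \<le> divdiff_tolerance B n q y i})"
    unfolding net_event_def
    by (intro finite_measure_subadditive_finite finite_separated_configs image_subsetI sets_divdiff_small)
  also have "\<dots> \<le> real (card ?S) * ((?c\<^sup>2) ^ n * V / ?W)"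
    by (rule sum_bounded_above) (rule each)
  also have "\<dots> \<le> (9 * R\<^sup>2 * ?s\<^sup>2) ^ n * ((?c\<^sup>2) ^ n * V / ?W)"
    using cardS W \<open>V \<ge> 0\<close> by (intro mult_right_mono) auto
  also have "\<dots> = (9 * R\<^sup>2 * ?s\<^sup>2 * ?c\<^sup>2) ^ n * V / ?W"
    by (simp only: power_mult_distrib times_divide_eq_right mult.assoc)
  also have "9 * R\<^sup>2 * ?s\<^sup>2 * ?c\<^sup>2 = 9 * R\<^sup>2 * (?s * ?c)\<^sup>2"
    by (simp only: power_mult_distrib mult.assoc)
  also have "?s * ?c = 2 * real n * B * 8 ^ n"
    by simp
  finally show ?thesis .
qed

text \<open>
  Every outcome in question lies in the net events for all sufficiently fine meshes, hence in their
  limit inferior \<open>U\<close>, whose probability inherits a bound that does not depend on the mesh.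
\<close>
lemma prob_many_close_zeros_uncrowded:
  assumes "L > 0" "\<tau> \<ge> 2" "0 < \<sigma>" "\<sigma> \<le> 1" "R = \<tau> + 1" "m = L * R\<^sup>2"
  shows "\<exists>U\<in>events. many_close_zeros M \<zeta> L \<tau> \<sigma> k \<inter> regular_outcomes
      \<inter> {\<omega>\<in>space M. tempered m (\<lambda>n. \<zeta> n \<omega>)} - small_coeffs m \<subseteq> U \<and>
    prob U \<le> (\<Sum>n<max_zeros m. config_bound L R \<sigma> k n)"
proof -
  define A where "A q = (\<Union>n<max_zeros m. net_event L R (6 * exp (197 * m) / (6 * R) ^ n) (2 * \<sigma> ^ k * (2 * R) ^ n\<^sup>2) n q)" for q
  have R: "R \<ge> 3" "R > 0" "R \<ge> 1" using assms by auto
  have A: "A q \<in> events" for q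
    unfolding A_def by measurable
  have "prob (A q) \<le> (\<Sum>n<max_zeros m. config_bound L R \<sigma> k n)" for q
  proof -
    have "prob (A q) \<le> (\<Sum>n<max_zeros m. prob (net_event L R (6 * exp (197 * m) / (6 * R) ^ n) (2 * \<sigma> ^ k * (2 * R) ^ n\<^sup>2) n q))"
      unfolding A_def by (intro finite_measure_subadditive_finite) auto
    also have "\<dots> \<le> (\<Sum>n<max_zeros m. config_bound L R \<sigma> k n)"
      unfolding config_bound_def assms(6)
      by (intro sum_mono prob_net_event_le) (use assms R in auto)
    finally show ?thesis .
  qed
  note U = prob_liminf_le[of A, OF A this]
  have "\<omega> \<in> (\<Union>p. \<Inter>q\<in>{p..}. A q)" if \<omega>: "\<omega> \<in> many_close_zeros M \<zeta> L \<tau> \<sigma> k" "\<omega> \<in> regular_outcomes"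
     "tempered m (\<lambda>n. \<zeta> n \<omega>)" "\<omega> \<notin> small_coeffs m" for \<omega>
  proof -
    let ?a = "\<lambda>n. \<zeta> n \<omega>"
    define X where "X = cball 0 R \<inter> GEF_zeros L ?a"
    define n where "n = card X"
    have M: "\<omega> \<in> space M" using \<omega>(2) by (simp add: regular_outcomes_def)
    have X: "finite X" "X \<subseteq> cball 0 R \<inter> GEF_zeros L ?a"
      unfolding X_def using finite_zeros_regular[OF \<omega>(2) \<open>L > 0\<close>] by auto
    have n: "n < max_zeros m"
      using crowded_imp_small_coeffs[OF M \<omega>(3) assms(1) R(2) assms(6) X] \<omega>(4) unfolding n_def by (meson not_le)
    have "k \<le> card (close_points \<tau> \<sigma> X)"
      using \<omega>(1) unfolding X_def assms(5) close_points_zeros by (simp add: many_close_zeros_def)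
    then have "(\<Prod>z\<in>X. \<Prod>w\<in>X-{z}. cmod (z - w)) \<le> \<sigma> ^ k * (2 * R) ^ (card X)\<^sup>2"
      using X R assms by (intro prod_dist_close_points_le) auto
    also have "\<dots> < 2 * \<sigma> ^ k * (2 * R) ^ n\<^sup>2"
      using \<open>0 < \<sigma>\<close> R by (simp add: n_def)
    finally have "\<forall>\<^sub>F q in sequentially. \<exists>y\<in>separated_configs R (2 * \<sigma> ^ k * (2 * R) ^ n\<^sup>2) n q. \<forall>i<n.
     cmod (of_real (gef_weight L i) * ?a i + divdiff_tail L y i ?a)
       \<le> divdiff_tolerance (6 * exp (197 * m) / (6 * R) ^ n) n q y i"
      by (intro eventually_near_config[OF \<omega>(3) assms(1) R(3) assms(6) X n_def])
    then have "\<forall>\<^sub>F q in sequentially. \<omega> \<in> A q"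
    proof eventually_elim
      case (elim q)
      then have "\<omega> \<in> net_event L R (6 * exp (197 * m) / (6 * R) ^ n) (2 * \<sigma> ^ k * (2 * R) ^ n\<^sup>2) n q"
        using M unfolding net_event_def divdiff_tail_restrict by (simp only: atLeast0LessThan lessThan_iff Ball_def) blast
      then show ?case using n by (auto simp: A_def)
    qed
    then show ?thesis by (auto simp: eventually_sequentially)
  qed
  then show ?thesis
    using U by (intro bexI[of _ "\<Union>p. \<Inter>q\<in>{p..}. A q"]) auto
qed

end

section \<open>Size of the bounds\<close>

lemma inverse_gef_weight_prod_le:
  assumes "L > 0" "inverse L \<le> exp \<l>" "\<l> \<ge> 0" "n \<le> N" "real N \<le> exp (12 * \<l>)"
  shows "inverse (\<Prod>i<n. (gef_weight L i)\<^sup>2) \<le> exp (13 * \<l> * (real N)\<^sup>2)"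
proof -
  have "inverse (\<Prod>i<n. (gef_weight L i)\<^sup>2) = (\<Prod>i<n. inverse ((gef_weight L i)\<^sup>2))"
    using prod_inversef[of "\<lambda>i. (gef_weight L i)\<^sup>2" "{..<n}"] by (simp add: o_def)
  also have "\<dots> \<le> (\<Prod>i<n. exp (13 * \<l> * real N))"
  proof (intro prod_mono conjI)
    fix i assume "i \<in> {..<n}"
    then have i: "i \<le> N" using assms by simp
    have "fact i \<le> (of_nat (i ^ i) :: real)" by (rule fact_le_power)
    also have "\<dots> \<le> exp (12 * \<l>) ^ i"
      using i assms(5) by (simp, intro power_mono) auto
    finally have f: "fact i \<le> exp (12 * \<l>) ^ i" .
    have "inverse ((gef_weight L i)\<^sup>2) = fact i * inverse L ^ i"
      using \<open>L > 0\<close> by (simp add: gef_weight_def field_simps)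
    also have "\<dots> \<le> exp (12 * \<l>) ^ i * exp \<l> ^ i"
      using f assms by (intro mult_mono power_mono) auto
    also have "\<dots> = exp (real i * (13 * \<l>))"
      by (simp only: power_mult_distrib[symmetric] exp_add[symmetric] exp_of_nat_mult) simp
    also have "\<dots> \<le> exp (13 * \<l> * real N)"
      using i \<open>\<l> \<ge> 0\<close> by (simp add: mult.commute mult_left_mono)
    finally show "inverse ((gef_weight L i)\<^sup>2) \<le> exp (13 * \<l> * real N)" .
  qed simp
  also have "\<dots> = exp (real n * (13 * \<l> * real N))"
    by (simp add: exp_of_nat_mult)
  also have "\<dots> \<le> exp (13 * \<l> * (real N)\<^sup>2)"
  proof -
    have "real n * (13 * \<l> * real N) \<le> real N * (13 * \<l> * real N)"
      using assms by (intro mult_right_mono) auto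
    then show ?thesis by (simp add: power2_eq_square mult_ac)
  qed
  finally show ?thesis .
qed

text \<open>
  The logarithm of every factor other than \<open>\<sigma>\<^sup>k\<close> is at most a constant times \<open>\<l> N\<^sup>2\<close>. The constant \<open>457\<close> is \<open>440 + 1 + 3 + 13\<close>, from the
  parts \<open>b1\<close>, \<open>b2\<close> (twice) and \<open>b3\<close> below.
\<close>
lemma config_bound_le:
  assumes "L > 0" "R \<ge> 1" "\<sigma> > 0" "\<l> \<ge> 1" "R \<le> exp (2 * \<l>)" "inverse L \<le> exp \<l>"
    "n \<le> N" "N \<ge> 1" "real N \<le> exp (12 * \<l>)" "L * R\<^sup>2 \<le> real N"
  shows "config_bound L R \<sigma> k n \<le> exp (457 * \<l> * (real N)\<^sup>2) * \<sigma> ^ k"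
proof -
  define K where "K = \<l> * real N"
  have N1: "1 \<le> real N" using assms by simp
  have K: "\<l> \<le> K" "real N \<le> K" "1 \<le> K"
  proof -
    show "\<l> \<le> K" using N1 \<open>\<l> \<ge> 1\<close> by (simp add: K_def)
    show "real N \<le> K" using N1 \<open>\<l> \<ge> 1\<close> by (simp add: K_def)
    then show "1 \<le> K" using N1 by linarith
  qed
  have two: "2 \<le> exp (1::real)" using exp_ge_add_one_self[of "1::real"] by simp
  have p: "x \<le> exp (real j * y)" if "x \<le> 2 ^ j" "y \<ge> 1" for x y :: real and j
  proof -
    have "x \<le> 2 ^ j" by fact
    also have "\<dots> \<le> exp 1 ^ j" using two by (intro power_mono) auto
    also have "\<dots> = exp (real j)" by (simp flip: exp_of_nat_mult)
    also have "\<dots> \<le> exp (real j * y)" using \<open>y \<ge> 1\<close> by (simp add: mult_left_mono[of 1 y "real j", simplified])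
    finally show ?thesis .
  qed
  have R: "R \<le> exp (2 * K)"
  proof -
    have "exp (2 * \<l>) \<le> exp (2 * K)" using K(1) by simp
    with assms(5) show ?thesis by linarith
  qed
  have nK: "real n \<le> K" using assms(7) K(2) by linarith
  have a1: "9 * R\<^sup>2 \<le> exp (8 * K)"
  proof -
    have "9 * R\<^sup>2 \<le> exp (real 4 * K) * (exp (2 * K))\<^sup>2"
      using p[of 9 4 K] K R assms(2) by (intro mult_mono power_mono) auto
    also have "\<dots> = exp (8 * K)" by (simp add: power2_eq_square mult_exp_exp)
    finally show ?thesis .
  qed
  have a2: "2 * real n * (6 * exp (197 * (L * R\<^sup>2)) / (6 * R) ^ n) * 8 ^ n \<le> exp (216 * K)"
  proof -
    have "6 * exp (197 * (L * R\<^sup>2)) / (6 * R) ^ n \<le> 6 * exp (197 * (L * R\<^sup>2)) / 1"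
      using assms(2) by (intro divide_left_mono one_le_power) auto
    also have "\<dots> \<le> 6 * exp (197 * K)"
      using assms(10) K(2) by simp
    finally have "2 * real n * (6 * exp (197 * (L * R\<^sup>2)) / (6 * R) ^ n) * 8 ^ n \<le> 2 * real n * (6 * exp (197 * K)) * 8 ^ n"
      by (intro mult_right_mono mult_left_mono) auto
    also have "\<dots> = 12 * real n * exp (197 * K) * 8 ^ n" by simp
    also have "\<dots> \<le> exp (real 4 * K) * exp (12 * K) * exp (197 * K) * exp (3 * K)"
    proof (intro mult_mono)
      show "12 \<le> exp (real 4 * K)" using p[of 12 4 K] K by simp
      have "real n \<le> real N" using assms(7) by simp
      also have "\<dots> \<le> exp (12 * \<l>)" by fact
      also have "\<dots> \<le> exp (12 * K)" using K by simp
      finally show "real n \<le> exp (12 * K)" .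
      have "(8::real) ^ n = 2 ^ (3 * n)" by (simp add: power_mult)
      then have "8 ^ n \<le> exp (real (3 * n) * 1)" by (intro p) auto
      also have "\<dots> \<le> exp (3 * K)" using nK by simp
      finally show "8 ^ n \<le> exp (3 * K)" .
    qed auto
    also have "\<dots> = exp (216 * K)" by (simp add: mult_exp_exp)
    finally show ?thesis .
  qed
  have nonneg: "0 \<le> 2 * real n * (6 * exp (197 * (L * R\<^sup>2)) / (6 * R) ^ n) * 8 ^ n"
    using assms(2) by simp
  have base: "9 * R\<^sup>2 * (2 * real n * (6 * exp (197 * (L * R\<^sup>2)) / (6 * R) ^ n) * 8 ^ n)\<^sup>2 \<le> exp (440 * K)"
  proof -
    have "9 * R\<^sup>2 * (2 * real n * (6 * exp (197 * (L * R\<^sup>2)) / (6 * R) ^ n) * 8 ^ n)\<^sup>2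
        \<le> exp (8 * K) * (exp (216 * K))\<^sup>2"
      by (intro mult_mono a1 power_mono a2 nonneg) auto
    also have "\<dots> = exp (440 * K)" by (simp add: power2_eq_square mult_exp_exp)
    finally show ?thesis .
  qed
  have NK: "real n * K \<le> \<l> * (real N)\<^sup>2"
  proof -
    have "real n * K \<le> real N * K" using assms(7) K by (intro mult_right_mono) auto
    then show ?thesis by (simp add: K_def power2_eq_square mult_ac)
  qed
  have b1: "(9 * R\<^sup>2 * (2 * real n * (6 * exp (197 * (L * R\<^sup>2)) / (6 * R) ^ n) * 8 ^ n)\<^sup>2) ^ n \<le> exp (440 * (\<l> * (real N)\<^sup>2))"
  proof -
    have "(9 * R\<^sup>2 * (2 * real n * (6 * exp (197 * (L * R\<^sup>2)) / (6 * R) ^ n) * 8 ^ n)\<^sup>2) ^ n \<le> exp (440 * K) ^ n"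
      using base by (intro power_mono) auto
    also have "\<dots> = exp (440 * (real n * K))" by (simp add: mult_ac flip: exp_of_nat_mult)
    also have "\<dots> \<le> exp (440 * (\<l> * (real N)\<^sup>2))" using NK by simp
    finally show ?thesis .
  qed
  define Q where "Q = \<l> * (real N)\<^sup>2"
  have Q1: "1 \<le> Q"
    unfolding Q_def using N1 \<open>\<l> \<ge> 1\<close> by (metis mult_mono' mult_1 one_le_power zero_le_one)
  have b2: "2 * \<sigma> ^ k * (2 * R) ^ n\<^sup>2 \<le> exp Q * \<sigma> ^ k * exp (3 * Q)"
  proof (intro mult_mono)
    have "exp 1 \<le> exp Q" using Q1 by simp
    with two show "2 \<le> exp Q" by linarith
    have "2 * R \<le> exp 1 * exp (2 * \<l>)"
      using two assms(2,5) by (intro mult_mono) auto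
    also have "\<dots> \<le> exp (3 * \<l>)" using \<open>\<l> \<ge> 1\<close> by (simp add: mult_exp_exp)
    finally have "(2 * R) ^ n\<^sup>2 \<le> exp (3 * \<l>) ^ n\<^sup>2"
      using assms(2) by (intro power_mono) auto
    also have "\<dots> = exp (real (n\<^sup>2) * (3 * \<l>))" by (rule exp_of_nat_mult[symmetric])
    also have "\<dots> \<le> exp (3 * Q)"
    proof -
      have "(real n)\<^sup>2 \<le> (real N)\<^sup>2" using assms(7) by (intro power_mono) auto
      then have "(real n)\<^sup>2 * (3 * \<l>) \<le> (real N)\<^sup>2 * (3 * \<l>)"
        using \<open>\<l> \<ge> 1\<close> by (intro mult_right_mono) auto
      then show ?thesis by (simp add: Q_def mult_ac)
    qed
    finally show "(2 * R) ^ n\<^sup>2 \<le> exp (3 * Q)" .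
  qed (use assms in auto)
  have W: "(\<Prod>i<n. (gef_weight L i)\<^sup>2) > 0"
    by (intro prod_pos zero_less_power gef_weight_pos \<open>L > 0\<close>)
  have b3: "inverse (\<Prod>i<n. (gef_weight L i)\<^sup>2) \<le> exp (13 * Q)"
    using inverse_gef_weight_prod_le[OF assms(1,6) _ assms(7,9)] \<open>\<l> \<ge> 1\<close> by (simp add: Q_def mult.assoc)
  have "(9 * R\<^sup>2 * (2 * real n * (6 * exp (197 * (L * R\<^sup>2)) / (6 * R) ^ n) * 8 ^ n)\<^sup>2) ^ n *
     (2 * \<sigma> ^ k * (2 * R) ^ n\<^sup>2) * inverse (\<Prod>i<n. (gef_weight L i)\<^sup>2)
    \<le> exp (440 * Q) * (exp Q * \<sigma> ^ k * exp (3 * Q)) * exp (13 * Q)"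
    using W assms by (intro mult_mono b1[folded Q_def] b2 b3) auto
  also have "\<dots> = exp (457 * Q) * \<sigma> ^ k"
    by (simp add: mult_exp_exp mult_ac)
  finally show ?thesis
    by (simp add: config_bound_def Q_def divide_inverse mult.assoc)
qed

lemma real_max_zeros_le:
  assumes "m \<ge> 1 / 100"
  shows "198 * m \<le> real (max_zeros m)" "real (max_zeros m) \<le> 600 * m"
  unfolding max_zeros_def using assms by linarith+

text \<open>
  With \<open>T = max L (1/L) \<tau>\<close>, each of \<open>L\<close>, \<open>1/L\<close> and \<open>\<tau>\<close> is at most \<open>T\<close>, and \<open>T \<le> exp \<l>\<close>. Moreover
  \<open>N\<^sup>2\<close> is at most a multiple of \<open>m\<^sup>2\<close>, that is of \<open>L\<^sup>2 \<tau>\<^sup>4\<close>; this is where \<open>m\<close> has to be bounded away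
  from \<open>0\<close>.
\<close>
lemma sum_config_bound_le:
  fixes L \<tau> :: real
  assumes "L > 0" "\<tau> \<ge> 2" "\<sigma> > 0" "R = \<tau> + 1" "m = L * R\<^sup>2" "m \<ge> 1 / 100"
    and \<l>: "\<l> = log_star (max L (inverse L) * \<tau>)"
  shows "(\<Sum>n<max_zeros m. config_bound L R \<sigma> k n) \<le> exp (10 ^ 10 * L\<^sup>2 * \<tau> ^ 4 * \<l>) * \<sigma> ^ k"
proof -
  define N where "N = max_zeros m"
  define T where "T = max L (inverse L) * \<tau>"
  have N: "198 * m \<le> real N" "real N \<le> 600 * m"
    unfolding N_def using real_max_zeros_le[OF assms(6)] by auto
  have "1 \<le> max L (inverse L)"
    using \<open>L > 0\<close> by (cases "L \<ge> 1") (auto simp: le_max_iff_disj one_le_inverse_iff)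
  then have T: "L \<le> T" "inverse L \<le> T" "\<tau> \<le> T"
  proof -
    have "max L (inverse L) * 1 \<le> T"
      unfolding T_def using \<open>\<tau> \<ge> 2\<close> \<open>1 \<le> max L (inverse L)\<close> by (intro mult_left_mono) auto
    then show "L \<le> T" "inverse L \<le> T" by auto
    have "1 * \<tau> \<le> T"
      unfolding T_def using \<open>\<tau> \<ge> 2\<close> \<open>1 \<le> max L (inverse L)\<close> by (intro mult_right_mono) auto
    then show "\<tau> \<le> T" by simp
  qed
  have "T > 0" using T \<open>\<tau> \<ge> 2\<close> by linarith
  have \<l>1: "\<l> \<ge> 1" and "ln T \<le> \<l>"
    unfolding \<l> T_def log_star_def by auto
  then have Te: "T \<le> exp \<l>"
    using \<open>T > 0\<close> by (metis exp_le_cancel_iff exp_ln)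
  have e: "5 / 2 \<le> exp (1 :: real)"
    using exp_lower_Taylor_quadratic[of "1 :: real"] by simp
  have e\<l>: "exp 1 \<le> exp \<l>" using \<l>1 by simp
  have e2: "5 / 2 \<le> exp \<l>" using e e\<l> by linarith
  have R\<tau>: "R \<le> 3 / 2 * \<tau>" "R \<ge> 3" using assms by auto
  have Rle: "R \<le> exp (2 * \<l>)"
  proof -
    have "R \<le> 3 / 2 * \<tau>" by (rule R\<tau>)
    also have "\<dots> \<le> exp \<l> * exp \<l>"
      using e e\<l> T Te \<open>\<tau> \<ge> 2\<close> by (intro mult_mono) linarith+
    finally show ?thesis by (simp add: mult_exp_exp)
  qed
  have m5: "m \<le> exp (5 * \<l>)"
  proof -
    have "m \<le> exp \<l> * (exp (2 * \<l>))\<^sup>2"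
      unfolding assms(5) using T Te Rle R\<tau> \<open>L > 0\<close> by (intro mult_mono power_mono) auto
    also have "\<dots> = exp (5 * \<l>)" by (simp add: power2_eq_square mult_exp_exp)
    finally show ?thesis .
  qed
  have Nexp: "real N \<le> exp (12 * \<l>)"
  proof -
    have "real N \<le> 600 * exp (5 * \<l>)" using N(2) m5 by linarith
    also have "(600::real) \<le> (5 / 2) ^ 7" by (simp add: power_divide)
    also have "(5 / 2 :: real) ^ 7 \<le> exp \<l> ^ 7"
      using e2 by (intro power_mono) auto
    also have "exp \<l> ^ 7 = exp (7 * \<l>)" by (simp flip: exp_of_nat_mult)
    finally show ?thesis by (simp add: mult_exp_exp)
  qed
  have "N \<ge> 1" by (simp add: N_def max_zeros_def)
  have each: "config_bound L R \<sigma> k n \<le> exp (457 * \<l> * (real N)\<^sup>2) * \<sigma> ^ k" if "n < N" for n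
  proof (rule config_bound_le)
    show "L * R\<^sup>2 \<le> real N" using N(1) assms(5,6) by linarith
    show "inverse L \<le> exp \<l>" using T Te by linarith
  qed (use assms \<l>1 Rle that \<open>N \<ge> 1\<close> Nexp in auto)
  have "(\<Sum>n<N. config_bound L R \<sigma> k n) \<le> real (card {..<N}) * (exp (457 * \<l> * (real N)\<^sup>2) * \<sigma> ^ k)"
    by (rule sum_bounded_above) (use each in auto)
  also have "\<dots> \<le> exp (12 * \<l> * (real N)\<^sup>2) * (exp (457 * \<l> * (real N)\<^sup>2) * \<sigma> ^ k)"
  proof (rule mult_right_mono)
    have "12 * \<l> * 1 \<le> 12 * \<l> * (real N)\<^sup>2"
      using \<open>N \<ge> 1\<close> \<l>1 by (intro mult_left_mono one_le_power) auto
    then have "exp (12 * \<l>) \<le> exp (12 * \<l> * (real N)\<^sup>2)" by simp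
    then show "real (card {..<N}) \<le> exp (12 * \<l> * (real N)\<^sup>2)"
      unfolding card_lessThan using Nexp by linarith
  qed (use \<open>\<sigma> > 0\<close> in simp)
  also have "\<dots> = exp (469 * \<l> * (real N)\<^sup>2) * \<sigma> ^ k"
    by (simp add: mult_exp_exp mult.assoc[symmetric] distrib_right[symmetric])
  also have "\<dots> \<le> exp (10 ^ 10 * L\<^sup>2 * \<tau> ^ 4 * \<l>) * \<sigma> ^ k"
  proof -
    have "(real N)\<^sup>2 \<le> (600 * m)\<^sup>2" using N(2) by (intro power_mono) auto
    also have "\<dots> = 360000 * L\<^sup>2 * R ^ 4"
      unfolding assms(5) by (simp add: power_mult_distrib flip: power_mult)
    also have "\<dots> \<le> 360000 * L\<^sup>2 * (3 / 2 * \<tau>) ^ 4"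
      using R\<tau> by (intro mult_left_mono power_mono) auto
    also have "\<dots> = 1822500 * (L\<^sup>2 * \<tau> ^ 4)"
      by (simp add: power_mult_distrib power_divide)
    finally have "469 * \<l> * (real N)\<^sup>2 \<le> 469 * \<l> * (1822500 * (L\<^sup>2 * \<tau> ^ 4))"
      using \<l>1 by (intro mult_left_mono) auto
    also have "\<dots> = 854752500 * (L\<^sup>2 * \<tau> ^ 4 * \<l>)" by simp
    also have "\<dots> \<le> 10 ^ 10 * (L\<^sup>2 * \<tau> ^ 4 * \<l>)"
      using \<l>1 by (intro mult_right_mono) auto
    finally have "exp (469 * \<l> * (real N)\<^sup>2) \<le> exp (10 ^ 10 * L\<^sup>2 * \<tau> ^ 4 * \<l>)"
      by (simp add: mult.assoc)
    then show ?thesis using \<open>\<sigma> > 0\<close> by (intro mult_right_mono) auto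
  qed
  finally show ?thesis by (simp add: N_def)
qed

section \<open>The tail estimate\<close>

context iid_complex_normal
begin

text \<open>
  Upper bounds need only a measurable set that covers the event on the regular outcomes.
\<close>
lemma measure_completion_le:
  assumes V: "V \<in> events" "E \<inter> regular_outcomes \<subseteq> V" "E \<subseteq> space M" and E: "E \<in> sets (completion M)"
  shows "measure (completion M) E \<le> prob V"
proof -
  interpret c: prob_space "completion M" by (rule prob_space_completion)
  have "E \<subseteq> V \<union> (space M - regular_outcomes)" using V by blast
  then have "measure (completion M) E \<le> measure (completion M) (V \<union> (space M - regular_outcomes))"
    using V(1) by (intro c.finite_measure_mono sets_completionI_sets) auto
  also have "\<dots> = prob (V \<union> (space M - regular_outcomes))"
    using V(1) by (intro measure_completion) auto
  also have "\<dots> = prob V"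
    using V(1) null_nonregular by (rule measure_Un_null_set)
  finally show ?thesis .
qed

lemma sets_many_close_zeros:
  assumes "L > 0"
  shows "many_close_zeros M \<zeta> L \<tau> \<sigma> k \<in> sets (completion M)"
proof (rule sets_completionI)
  let ?E = "many_close_zeros M \<zeta> L \<tau> \<sigma> k"
  show "?E = (?E \<inter> regular_outcomes) \<union> (?E - regular_outcomes)" by blast
  show "?E - regular_outcomes \<subseteq> space M - regular_outcomes" by (auto simp: many_close_zeros_def)
qed (rule null_nonregular sets_many_close_zeros_regular[OF assms])+

text \<open>
  For small \<open>m\<close> the disc contains no zero with probability at least \<open>1/2\<close>, and
  \<open>exp (- L\<^sup>2 \<tau>\<^sup>4) \<ge> 1/2\<close>.
\<close>
lemma prob_many_close_zeros_sparse:
  assumes "L > 0" "\<tau> \<ge> 2" "k \<ge> 1" "L * (\<tau> + 1)\<^sup>2 \<le> 1 / 100"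
  shows "measure (completion M) (many_close_zeros M \<zeta> L \<tau> \<sigma> k) \<le> exp (- (L\<^sup>2 * \<tau> ^ 4))"
proof -
  define R where "R = \<tau> + 1"
  define m where "m = L * R\<^sup>2"
  have m: "m > 0" "m \<le> 1 / 100" using assms by (auto simp: m_def R_def)
  let ?E = "many_close_zeros M \<zeta> L \<tau> \<sigma> k"
  let ?T = "{\<omega>\<in>space M. \<not> tempered m (\<lambda>n. \<zeta> n \<omega>)}"
  let ?S = "{\<omega>\<in>space M. \<zeta> 0 \<omega> \<in> cball 0 (1 / 2)}"
  have S: "?S \<in> events"
    using measurable_sets[OF measurable_coeff[of 0], of "cball 0 (1 / 2)"]
    by (simp add: vimage_def Int_def conj_commute)
  have "?E \<subseteq> ?T \<union> ?S"
  proof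
    fix \<omega> assume \<omega>: "\<omega> \<in> ?E"
    show "\<omega> \<in> ?T \<union> ?S"
    proof (rule ccontr)
      assume no: "\<omega> \<notin> ?T \<union> ?S"
      have M: "\<omega> \<in> space M" using \<omega> by (simp add: many_close_zeros_def)
      with no have t: "tempered m (\<lambda>n. \<zeta> n \<omega>)" "cmod (\<zeta> 0 \<omega>) > 1 / 2" by auto
      have "GEF L (\<lambda>n. \<zeta> n \<omega>) z \<noteq> 0" if "z \<in> ball 0 \<tau>" for z
        by (rule GEF_no_zeros_small[where R = R and t = m])
          (use t m that assms in \<open>auto simp: R_def m_def\<close>)
      then have "ball 0 \<tau> \<inter> GEF_zeros L (\<lambda>n. \<zeta> n \<omega>) = {}" by (auto simp: GEF_zeros_def)
      then have "{z \<in> ball 0 \<tau> \<inter> GEF_zeros L (\<lambda>n. \<zeta> n \<omega>). prod_sep L (\<lambda>n. \<zeta> n \<omega>) z < \<sigma>} = {}" (is "?Z = _")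
        by blast
      moreover have "k \<le> card ?Z" using \<omega> unfolding many_close_zeros_def by blast
      ultimately have "k \<le> 0" by (simp only: card.empty)
      then show False using \<open>k \<ge> 1\<close> by simp
    qed
  qed
  then have "measure (completion M) ?E \<le> prob (?T \<union> ?S)"
    using S by (intro measure_completion_le sets_many_close_zeros assms(1)) (auto simp: many_close_zeros_def)
  also have "\<dots> \<le> prob ?T + prob ?S"
    using S by (intro measure_Un_le) auto
  also have "\<dots> \<le> 1 / 4 + 1 / 4"
  proof (rule add_mono)
    have "prob ?T \<le> exp (- m\<^sup>2) / 4" by (rule prob_not_tempered)
    also have "\<dots> \<le> 1 / 4" by simp
    finally show "prob ?T \<le> 1 / 4" .
    show "prob ?S \<le> 1 / 4" using prob_coeff_cball_le[of "1 / 2" 0 0] by (simp add: power2_eq_square)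
  qed
  also have "1 / 4 + 1 / 4 \<le> 1 - L\<^sup>2 * \<tau> ^ 4"
  proof -
    have "L\<^sup>2 * \<tau> ^ 4 \<le> L\<^sup>2 * R ^ 4"
      using \<open>\<tau> \<ge> 2\<close> by (intro mult_left_mono power_mono) (auto simp: R_def)
    also have "\<dots> = m\<^sup>2" by (simp add: m_def power_mult_distrib flip: power_mult)
    also have "\<dots> \<le> (1 / 100)\<^sup>2" using m by (intro power_mono) auto
    finally show ?thesis by (simp add: power2_eq_square)
  qed
  also have "\<dots> \<le> exp (- (L\<^sup>2 * \<tau> ^ 4))"
    using exp_ge_add_one_self[of "- (L\<^sup>2 * \<tau> ^ 4)"] by simp
  finally show ?thesis .
qed

text \<open>
  The coefficients are not tempered, or they are small because of overcrowding, or there are fewer than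
  \<open>max_zeros m\<close> zeros. The first two cases have total probability at most \<open>3/4 exp (- m\<^sup>2)\<close>.
\<close>
lemma prob_many_close_zeros_dense:
  assumes "L > 0" "\<tau> \<ge> 2" "0 < \<sigma>" "\<sigma> \<le> 1" "L * (\<tau> + 1)\<^sup>2 \<ge> 1 / 100"
  shows "measure (completion M) (many_close_zeros M \<zeta> L \<tau> \<sigma> k)
    \<le> exp (- (L\<^sup>2 * \<tau> ^ 4))
       + exp (10 ^ 10 * L\<^sup>2 * \<tau> ^ 4 * log_star (max L (inverse L) * \<tau>)) * \<sigma> ^ k"
proof -
  define R where "R = \<tau> + 1"
  define m where "m = L * R\<^sup>2"
  have m: "m \<ge> 1 / 100" "m > 0" using assms by (auto simp: m_def R_def)
  let ?E = "many_close_zeros M \<zeta> L \<tau> \<sigma> k"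
  let ?T = "{\<omega>\<in>space M. \<not> tempered m (\<lambda>n. \<zeta> n \<omega>)}"
  obtain U where U: "U \<in> events"
    "?E \<inter> regular_outcomes \<inter> {\<omega>\<in>space M. tempered m (\<lambda>n. \<zeta> n \<omega>)} - small_coeffs m \<subseteq> U"
    "prob U \<le> (\<Sum>n<max_zeros m. config_bound L R \<sigma> k n)"
    using prob_many_close_zeros_uncrowded[OF assms(1-4) R_def m_def] by blast
  have "?E \<inter> regular_outcomes \<subseteq> (?T \<union> small_coeffs m) \<union> U"
    using U(2) by (auto simp: many_close_zeros_def)
  then have "measure (completion M) ?E \<le> prob ((?T \<union> small_coeffs m) \<union> U)"
    using U(1) by (intro measure_completion_le sets_many_close_zeros assms(1)) (auto simp: many_close_zeros_def)
  also have "\<dots> \<le> prob (?T \<union> small_coeffs m) + prob U"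
    using U(1) by (intro measure_Un_le) auto
  also have "prob (?T \<union> small_coeffs m) \<le> prob ?T + prob (small_coeffs m)"
    by (intro measure_Un_le) auto
  also have "prob ?T + prob (small_coeffs m) \<le> exp (- m\<^sup>2) / 4 + exp (- m\<^sup>2) / 2"
    by (intro add_mono prob_not_tempered prob_small_coeffs m)
  also have "\<dots> \<le> exp (- m\<^sup>2)" by simp
  also have "\<dots> \<le> exp (- (L\<^sup>2 * \<tau> ^ 4))"
  proof -
    have "L\<^sup>2 * \<tau> ^ 4 \<le> L\<^sup>2 * R ^ 4"
      using \<open>\<tau> \<ge> 2\<close> by (intro mult_left_mono power_mono) (auto simp: R_def)
    also have "\<dots> = m\<^sup>2" by (simp add: m_def power_mult_distrib flip: power_mult)
    finally show ?thesis by simp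
  qed
  also have "prob U \<le> exp (10 ^ 10 * L\<^sup>2 * \<tau> ^ 4 * log_star (max L (inverse L) * \<tau>)) * \<sigma> ^ k"
    using U(3) sum_config_bound_le[OF assms(1-3) R_def m_def m(1) refl, of k] by (rule order_trans)
  finally show ?thesis by simp
qed

lemma prob_many_close_zeros:
  assumes "L > 0" "\<tau> \<ge> 2" "\<sigma> > 0" "k \<ge> 1"
  shows "measure (completion M) (many_close_zeros M \<zeta> L \<tau> \<sigma> k)
    \<le> exp (- (L\<^sup>2 * \<tau> ^ 4))
       + exp (10 ^ 10 * L\<^sup>2 * \<tau> ^ 4 * log_star (max L (inverse L) * \<tau>)) * \<sigma> ^ k"
proof -
  let ?e = "exp (10 ^ 10 * L\<^sup>2 * \<tau> ^ 4 * log_star (max L (inverse L) * \<tau>))"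
  consider "\<sigma> > 1" | "\<sigma> \<le> 1" "L * (\<tau> + 1)\<^sup>2 \<le> 1 / 100" | "\<sigma> \<le> 1" "L * (\<tau> + 1)\<^sup>2 \<ge> 1 / 100"
    by linarith
  then show ?thesis
  proof cases
    case 1
    interpret c: prob_space "completion M" by (rule prob_space_completion)
    have "0 \<le> log_star (max L (inverse L) * \<tau>)" by (simp add: log_star_def)
    then have "1 \<le> ?e" by simp
    then have "1 * 1 \<le> ?e * \<sigma> ^ k"
      using 1 by (intro mult_mono one_le_power) auto
    moreover have "0 \<le> exp (- (L\<^sup>2 * \<tau> ^ 4))" by simp
    ultimately show ?thesis
      using c.prob_le_1[of "many_close_zeros M \<zeta> L \<tau> \<sigma> k"] by linarith
  next
    case 2
    have "0 \<le> ?e * \<sigma> ^ k" using \<open>\<sigma> > 0\<close> by simp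
    with prob_many_close_zeros_sparse[OF assms(1,2,4) 2(2), of \<sigma>] show ?thesis by linarith
  next
    case 3
    then show ?thesis using assms by (intro prob_many_close_zeros_dense) auto
  qed
qed

end

theorem proposition5p3:
  "\<exists>c C :: real. c > 0 \<and> C > 0 \<and>
     (\<forall>(M :: 'a measure) (\<zeta> :: nat \<Rightarrow> 'a \<Rightarrow> complex) (L :: real) (\<tau> :: real) (\<sigma> :: real) (k :: nat).
        iid_std_complex_normal M \<zeta> \<longrightarrow> L > 0 \<longrightarrow> \<tau> \<ge> 2 \<longrightarrow> \<sigma> > 0 \<longrightarrow> k \<ge> 1 \<longrightarrow>
        many_close_zeros M \<zeta> L \<tau> \<sigma> k \<in> sets (completion M) \<and>
        measure (completion M) (many_close_zeros M \<zeta> L \<tau> \<sigma> k)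
          \<le> exp (- c * L\<^sup>2 * \<tau> ^ 4)
             + exp (C * L\<^sup>2 * \<tau> ^ 4 * log_star (max L (inverse L) * \<tau>)) * \<sigma> ^ k)"
proof (rule exI[of _ 1], rule exI[of _ "10 ^ 10"], intro conjI allI impI)
  fix M :: "'a measure" and \<zeta> :: "nat \<Rightarrow> 'a \<Rightarrow> complex" and L \<tau> \<sigma> :: real and k :: nat
  assume "iid_std_complex_normal M \<zeta>" and *: "L > 0" "\<tau> \<ge> 2" "\<sigma> > 0" "k \<ge> 1"
  then interpret iid_complex_normal M \<zeta> by unfold_locales
  show "many_close_zeros M \<zeta> L \<tau> \<sigma> k \<in> sets (completion M)"
    by (rule sets_many_close_zeros[OF *(1)])
  show "measure (completion M) (many_close_zeros M \<zeta> L \<tau> \<sigma> k)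
          \<le> exp (- 1 * L\<^sup>2 * \<tau> ^ 4)
             + exp (10 ^ 10 * L\<^sup>2 * \<tau> ^ 4 * log_star (max L (inverse L) * \<tau>)) * \<sigma> ^ k"
    using prob_many_close_zeros[OF *] by simp
qed simp_all

end
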